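(* Let $K$ be a field and let $a,d\in\mathbb{N}^2$ be linearly independent over $\mathbb{Q}$ such that $\{a,a+d,a+2d,a+3d,a+4d\}$ is a minimal generating set of $S_{a,d,4}=\langle a,a+d,a+2d,a+3d,a+4d\rangle$. Let $R=K[x_1,x_2,x_3,x_4,x_5]$. Then the complex $$0\to R^3\xrightarrow{\delta_3}R^8\xrightarrow{\delta_2}R^6\xrightarrow{\delta_1}R\to R/I_{S_{a,d,4}}\to 0$$ is a minimal graded free resolution of $K[S_{a,d,4}]$, where $$\delta_1=\begin{pmatrix}x_2^2-x_1x_3 & x_2x_3-x_1x_4 & x_3^2-x_1x_5 & x_2x_4-x_1x_5 & x_3x_4-x_2x_5 & x_4^2-x_3x_5\end{pmatrix},$$ $$\delta_2=\begin{pmatrix} -x_3 & 0 & -x_4 & 0 & x_5 & 0 & 0 & 0\\ x_2 & -x_3 & 0 & -x_4 & 0 & x_5 & x_5 & 0\\ -x_1 & x_2 & 0 & 0 & 0 & -x_4 & 0 & x_5\\ x_1 & 0 & x_2 & x_3 & -x_3 & 0 & -x_4 & -x_5\\ 0 & -x_1 & -x_1 & 0 & x_2 & x_3 & 0 & -x_4\\ 0 & 0 & 0 & -x_1 & 0 & 0 & x_2 & x_3 \end{pmatrix},\qquad \delta_3=\begin{pmatrix} x_4 & -x_5 & 0\\ 0 & x_4 & -x_5\\ -x_3 & 0 & x_5\\ x_2 & -x_3 & 0\\ 0 & -x_3 & x_4\\ -x_1 & x_2 & 0\\ x_1 & 0 & -x_3\\ 0 & -x_1 & x_2 \end{pmat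rix}.$$
   Context: $\mathbb{N}$ denotes the set of non-negative integers. $\langle a_1,\ldots,a_n\rangle=\{\sum_i\lambda_i a_i\mid \lambda_i\in\mathbb{N}\}$ is the affine semigroup generated by $a_1,\ldots,a_n\in\mathbb{N}^r$. $K[S]=\bigoplus_{s\in S}K\mathbf{t}^s\subseteq K[t_1,\ldots,t_r]$ is the semigroup ring of $S$. The defining ideal $I_{S_{a,d,4}}$ is the kernel of the $K$-algebra homomorphism $R\to K[S_{a,d,4}]$, $x_i\mapsto\mathbf{t}^{a+(i-1)d}$, so $K[S_{a,d,4}]\cong R/I_{S_{a,d,4}}$. $R$ is graded by $\deg x_i=a+(i-1)d$, and the free modules carry the degree shifts making the maps degree-preserving. Matrices act on column vectors. *)

theory Defs
  imports
    "Jordan_Normal_Form.Matrix_Kernel"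
    "HOL-Algebra.QuotRing"
    "HOL-Library.Poly_Mapping"
    "HOL-Library.Product_Plus"
begin

section \<open>Polynomial rings\<close>

text \<open>
  The polynomial ring over \<open>'k\<close> in a finite set of variables \<open>'v\<close> is the monoid algebra
  \<open>('v \<Rightarrow>\<^sub>0 nat) \<Rightarrow>\<^sub>0 'k\<close>. Likewise \<open>(nat \<times> nat) \<Rightarrow>\<^sub>0 'k\<close> is \<open>K[t\<^sub>1,t\<^sub>2]\<close>, and
  \<open>t\<^sup>s\<close> is \<open>Poly_Mapping.single s 1\<close>.
\<close>

type_synonym ('v, 'k) mpol = "('v \<Rightarrow>\<^sub>0 nat) \<Rightarrow>\<^sub>0 'k"

definition Var :: "'v \<Rightarrow> ('v, 'k::zero_neq_one) mpol" where
  "Var i = Poly_Mapping.single (Poly_Mapping.single i 1) 1"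

definition mpol_eval ::
  "('k::zero \<Rightarrow> 'b::comm_semiring_1) \<Rightarrow> ('v::finite \<Rightarrow> 'b) \<Rightarrow> ('v, 'k) mpol \<Rightarrow> 'b" where
  "mpol_eval c t f =
    (\<Sum>m\<in>Poly_Mapping.keys f. c (Poly_Mapping.lookup f m) * (\<Prod>i\<in>UNIV. t i ^ Poly_Mapping.lookup m i))"

definition nscale :: "nat \<Rightarrow> 'g::comm_monoid_add \<Rightarrow> 'g" where
  "nscale n g = (\<Sum>i<n. g)"

text \<open>Here \<open>w i\<close> is the degree of the variable \<open>i\<close>.\<close>

definition monom_deg :: "('v::finite \<Rightarrow> 'g::comm_monoid_add) \<Rightarrow> ('v \<Rightarrow>\<^sub>0 nat) \<Rightarrow> 'g" where
  "monom_deg w m = (\<Sum>i\<in>UNIV. nscale (Poly_Mapping.lookup m i) (w i))"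

definition homog_comp ::
  "('v::finite \<Rightarrow> 'g::comm_monoid_add) \<Rightarrow> 'g \<Rightarrow> ('v, 'k::zero) mpol set" where
  "homog_comp w g = {f. \<forall>m\<in>Poly_Mapping.keys f. monom_deg w m = g}"

definition irrelevant_ideal :: "('v::finite, 'k::comm_ring_1) mpol set" where
  "irrelevant_ideal = Idl\<^bsub>class_ring\<^esub> (range Var)"


section \<open>Graded modules and minimal graded free resolutions\<close>

definition restrict_scalars :: "('r \<Rightarrow> 'm) \<Rightarrow> 'm ring \<Rightarrow> ('r, 'm) module" where
  "restrict_scalars h A =
    \<lparr>carrier = carrier A, mult = mult A, one = one A, zero = zero A, add = add A,
     smult = (\<lambda>r x. h r \<otimes>\<^bsub>A\<^esub> x)\<rparr>"

definition graded_module ::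
  "('v::finite \<Rightarrow> 'g::comm_monoid_add) \<Rightarrow> (('v, 'k::comm_ring_1) mpol, 'm) module \<Rightarrow>
   ('g \<Rightarrow> 'm set) \<Rightarrow> bool" where
  "graded_module w M Mg \<longleftrightarrow>
    module class_ring M \<and>
    (\<forall>g. subgroup (Mg g) (add_monoid M)) \<and>
    (\<forall>g h. \<forall>r\<in>homog_comp w g. \<forall>x\<in>Mg h. r \<odot>\<^bsub>M\<^esub> x \<in> Mg (g + h)) \<and>
    (\<forall>x\<in>carrier M. \<exists>!c. finite {g. c g \<noteq> \<zero>\<^bsub>M\<^esub>} \<and> (\<forall>g. c g \<in> Mg g) \<and>
       x = (\<Oplus>\<^bsub>M\<^esub>g\<in>{g. c g \<noteq> \<zero>\<^bsub>M\<^esub>}. c g))"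

text \<open>
  A list \<open>s\<close> of degrees stands for the graded free module whose \<open>j\<close>-th basis vector has degree
  \<open>s ! j\<close>, that is, for the direct sum of the \<open>R(-s ! j)\<close>.
\<close>

definition free_comp ::
  "('v::finite \<Rightarrow> 'g::comm_monoid_add) \<Rightarrow> 'g list \<Rightarrow> 'g \<Rightarrow> ('v, 'k::zero) mpol vec set" where
  "free_comp w s g =
    {v \<in> carrier_vec (length s).
       \<forall>j<length s. \<forall>m\<in>Poly_Mapping.keys (v $ j). monom_deg w m + s ! j = g}"

definition mat_image :: "'a::comm_ring_1 mat \<Rightarrow> 'a vec set" where
  "mat_image A = (\<lambda>v. A *\<^sub>v v) ` carrier_vec (dim_col A)"

text \<open>For a complex \<open>0 \<rightarrow> F\<^sub>p \<rightarrow> \<dots> \<rightarrow> F\<^sub>0\<close> with \<open>p = length ds\<close>: the image of the map into \<open>F\<^sub>i\<close>,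
  where \<open>n\<close> is the rank of \<open>F\<^sub>i\<close>. For \<open>i = p\<close> that map is \<open>0 \<rightarrow> F\<^sub>p\<close>.\<close>

definition incoming_image :: "'a::comm_ring_1 mat list \<Rightarrow> nat \<Rightarrow> nat \<Rightarrow> 'a vec set" where
  "incoming_image ds n i = (if i < length ds then mat_image (ds ! i) else {0\<^sub>v n})"

text \<open>
  The data describe the complex
  \<open>0 \<rightarrow> F\<^sub>p \<rightarrow> \<dots> \<rightarrow> F\<^sub>1 \<rightarrow> F\<^sub>0 \<rightarrow> M \<rightarrow> 0\<close>, where \<open>p = length ds\<close>, the graded free module \<open>F\<^sub>i\<close>
  is given by \<open>sh ! i\<close>, the map \<open>F\<^sub>i\<^sub>+\<^sub>1 \<rightarrow> F\<^sub>i\<close> is multiplication of column vectors by \<open>ds ! i\<close>, and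
  \<open>\<epsilon>\<close> is the map \<open>F\<^sub>0 \<rightarrow> M\<close>. The module \<open>M\<close> is graded by the components \<open>Mg g\<close>.
  Minimality is \<open>im(F\<^sub>i\<^sub>+\<^sub>1 \<rightarrow> F\<^sub>i) \<subseteq> \<mm> F\<^sub>i\<close> with \<open>\<mm>\<close> the ideal generated by the variables;
  note that \<open>\<mm> F\<^sub>i\<close> consists of the vectors with all entries in \<open>\<mm>\<close>.
\<close>

definition minimal_graded_free_resolution ::
  "('v::finite \<Rightarrow> 'g::comm_monoid_add) \<Rightarrow> 'g list list \<Rightarrow> ('v, 'k::comm_ring_1) mpol mat list \<Rightarrow>
   (('v, 'k) mpol vec \<Rightarrow> 'm) \<Rightarrow> (('v, 'k) mpol, 'm) module \<Rightarrow> ('g \<Rightarrow> 'm set) \<Rightarrow> bool" where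
  "minimal_graded_free_resolution w sh ds \<epsilon> M Mg \<longleftrightarrow>
    graded_module w M Mg \<and>
    length sh = Suc (length ds) \<and>
    (\<forall>i<length ds. ds ! i \<in> carrier_mat (length (sh ! i)) (length (sh ! Suc i))) \<and>
    mod_hom class_ring (module_vec TYPE(('v, 'k) mpol) (length (sh ! 0))) M \<epsilon> \<and>
    (\<forall>i<length ds. \<forall>g. \<forall>v\<in>free_comp w (sh ! Suc i) g. ds ! i *\<^sub>v v \<in> free_comp w (sh ! i) g) \<and>
    (\<forall>g. \<forall>v\<in>free_comp w (sh ! 0) g. \<epsilon> v \<in> Mg g) \<and>
    \<epsilon> ` carrier_vec (length (sh ! 0)) = carrier M \<and>
    {v \<in> carrier_vec (length (sh ! 0)). \<epsilon> v = \<zero>\<^bsub>M\<^esub>} = incoming_image ds (length (sh ! 0)) 0 \<and>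
    (\<forall>i<length ds. mat_kernel (ds ! i) = incoming_image ds (length (sh ! Suc i)) (Suc i)) \<and>
    (\<forall>i<length ds. \<forall>u\<in>mat_image (ds ! i). \<forall>j<length (sh ! i). u $ j \<in> irrelevant_ideal)"


section \<open>Affine semigroups and the defining ideal\<close>

text \<open>Only meant for finite \<open>A\<close>, since sums over infinite sets are \<open>0\<close>.\<close>

definition affine_semigroup :: "'g::comm_monoid_add set \<Rightarrow> 'g set" where
  "affine_semigroup A = {\<Sum>v\<in>A. nscale (l v) v | l. True}"

definition minimal_generating_set :: "'g::comm_monoid_add set \<Rightarrow> 'g set \<Rightarrow> bool" where
  "minimal_generating_set A S \<longleftrightarrow>
    affine_semigroup A = S \<and> (\<forall>B. B \<subset> A \<longrightarrow> affine_semigroup B \<noteq> S)"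

definition lin_indep_rat :: "nat \<times> nat \<Rightarrow> nat \<times> nat \<Rightarrow> bool" where
  "lin_indep_rat a d \<longleftrightarrow>
    (\<forall>p q :: rat. p * of_nat (fst a) + q * of_nat (fst d) = 0 \<and>
       p * of_nat (snd a) + q * of_nat (snd d) = 0 \<longrightarrow> p = 0 \<and> q = 0)"

definition semigroup_ring :: "'g::comm_monoid_add set \<Rightarrow> ('g \<Rightarrow>\<^sub>0 'k::comm_ring_1) ring" where
  "semigroup_ring S = class_ring\<lparr>carrier := {f. Poly_Mapping.keys f \<subseteq> S}\<rparr>"

definition semigroup_ring_comp ::
  "'g::comm_monoid_add set \<Rightarrow> 'g \<Rightarrow> ('g \<Rightarrow>\<^sub>0 'k::comm_ring_1) set" where
  "semigroup_ring_comp S g =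
    {f \<in> carrier (semigroup_ring S). Poly_Mapping.keys f \<subseteq> {g}}"

datatype var5 = V1 | V2 | V3 | V4 | V5

instance var5 :: finite
proof
  have "(UNIV :: var5 set) = {V1, V2, V3, V4, V5}"
    by (auto intro: var5.exhaust)
  then show "finite (UNIV :: var5 set)"
    by (metis finite.emptyI finite.insertI)
qed

fun wt :: "nat \<times> nat \<Rightarrow> nat \<times> nat \<Rightarrow> var5 \<Rightarrow> nat \<times> nat" where
  "wt a d V1 = a"
| "wt a d V2 = a + d"
| "wt a d V3 = a + nscale 2 d"
| "wt a d V4 = a + nscale 3 d"
| "wt a d V5 = a + nscale 4 d"

definition gens_ad4 :: "nat \<times> nat \<Rightarrow> nat \<times> nat \<Rightarrow> (nat \<times> nat) set" where
  "gens_ad4 a d = {a, a + d, a + nscale 2 d, a + nscale 3 d, a + nscale 4 d}"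

definition S_ad4 :: "nat \<times> nat \<Rightarrow> nat \<times> nat \<Rightarrow> (nat \<times> nat) set" where
  "S_ad4 a d = affine_semigroup (gens_ad4 a d)"

definition phi :: "nat \<times> nat \<Rightarrow> nat \<times> nat \<Rightarrow> (var5, 'k::comm_ring_1) mpol \<Rightarrow> (nat \<times> nat) \<Rightarrow>\<^sub>0 'k" where
  "phi a d = mpol_eval (Poly_Mapping.single 0) (\<lambda>i. Poly_Mapping.single (wt a d i) 1)"

definition I_ad4 :: "nat \<times> nat \<Rightarrow> nat \<times> nat \<Rightarrow> (var5, 'k::comm_ring_1) mpol set" where
  "I_ad4 a d = a_kernel class_ring (semigroup_ring (S_ad4 a d)) (phi a d)"

definition quot_map ::
  "nat \<times> nat \<Rightarrow> nat \<times> nat \<Rightarrow> (var5, 'k::comm_ring_1) mpol \<Rightarrow> (var5, 'k) mpol set" where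
  "quot_map a d f = I_ad4 a d +>\<^bsub>class_ring\<^esub> f"


section \<open>The matrices\<close>

abbreviation x1 :: "(var5, 'k::comm_ring_1) mpol" (\<open>x\<^sub>1\<close>) where "x\<^sub>1 \<equiv> Var V1"
abbreviation x2 :: "(var5, 'k::comm_ring_1) mpol" (\<open>x\<^sub>2\<close>) where "x\<^sub>2 \<equiv> Var V2"
abbreviation x3 :: "(var5, 'k::comm_ring_1) mpol" (\<open>x\<^sub>3\<close>) where "x\<^sub>3 \<equiv> Var V3"
abbreviation x4 :: "(var5, 'k::comm_ring_1) mpol" (\<open>x\<^sub>4\<close>) where "x\<^sub>4 \<equiv> Var V4"
abbreviation x5 :: "(var5, 'k::comm_ring_1) mpol" (\<open>x\<^sub>5\<close>) where "x\<^sub>5 \<equiv> Var V5"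

definition delta1 :: "(var5, 'k::comm_ring_1) mpol mat" (\<open>\<delta>\<^sub>1\<close>) where
  "\<delta>\<^sub>1 = mat_of_rows_list 6
    [[x\<^sub>2\<^sup>2 - x\<^sub>1 * x\<^sub>3, x\<^sub>2 * x\<^sub>3 - x\<^sub>1 * x\<^sub>4, x\<^sub>3\<^sup>2 - x\<^sub>1 * x\<^sub>5,
      x\<^sub>2 * x\<^sub>4 - x\<^sub>1 * x\<^sub>5, x\<^sub>3 * x\<^sub>4 - x\<^sub>2 * x\<^sub>5, x\<^sub>4\<^sup>2 - x\<^sub>3 * x\<^sub>5]]"

definition delta2 :: "(var5, 'k::comm_ring_1) mpol mat" (\<open>\<delta>\<^sub>2\<close>) where
  "\<delta>\<^sub>2 = mat_of_rows_list 8
    [[- x\<^sub>3,    0, - x\<^sub>4,    0,   x\<^sub>5,    0,    0,    0],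
     [  x\<^sub>2, - x\<^sub>3,    0, - x\<^sub>4,    0,   x\<^sub>5,   x\<^sub>5,    0],
     [- x\<^sub>1,   x\<^sub>2,    0,    0,    0, - x\<^sub>4,    0,   x\<^sub>5],
     [  x\<^sub>1,    0,   x\<^sub>2,   x\<^sub>3, - x\<^sub>3,    0, - x\<^sub>4, - x\<^sub>5],
     [   0, - x\<^sub>1, - x\<^sub>1,    0,   x\<^sub>2,   x\<^sub>3,    0, - x\<^sub>4],
     [   0,    0,    0, - x\<^sub>1,    0,    0,   x\<^sub>2,   x\<^sub>3]]"

definition delta3 :: "(var5, 'k::comm_ring_1) mpol mat" (\<open>\<delta>\<^sub>3\<close>) where
  "\<delta>\<^sub>3 = mat_of_rows_list 3
    [[  x\<^sub>4, - x\<^sub>5,    0],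
     [   0,   x\<^sub>4, - x\<^sub>5],
     [- x\<^sub>3,    0,   x\<^sub>5],
     [  x\<^sub>2, - x\<^sub>3,    0],
     [   0, - x\<^sub>3,   x\<^sub>4],
     [- x\<^sub>1,   x\<^sub>2,    0],
     [  x\<^sub>1,    0, - x\<^sub>3],
     [   0, - x\<^sub>1,   x\<^sub>2]]"

end

theory Submission
  imports Defs
begin

text \<open>
  Give \<open>x\<^sub>2\<close>, \<open>x\<^sub>3\<close>, \<open>x\<^sub>4\<close> the weight 1 and \<open>x\<^sub>1\<close>, \<open>x\<^sub>5\<close> the weight 0. Keeping only the terms of
  top weight in the entries of the matrices means putting \<open>x\<^sub>1 = x\<^sub>5 = 0\<close> there, and turns the
  complex into one that resolves \<open>R/(x\<^sub>2,x\<^sub>3,x\<^sub>4)\<^sup>2\<close>. For this monomial ideal exactness is a matter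
  of cancelling variables (\<open>syzygies_of_quadrics\<close>, \<open>second_syzygies_of_quadrics\<close>). Exactness then
  lifts to the original complex: the top-weight part of a cycle is a cycle of the leading complex,
  hence a boundary there, and subtracting the corresponding boundary of the original complex lowers
  the weight of the cycle (\<open>mat_kernel_eq_mat_image_by_leading_forms\<close>).

  The same subtraction shows that modulo the image of \<open>\<delta>\<^sub>1\<close> every polynomial is congruent to one
  whose monomials have weight at most 1 (\<open>reduce_mod_delta1\<close>). Since \<open>a\<close> and \<open>d\<close> are independent, the
  degree of a monomial in \<open>\<nat>\<^sup>2\<close> determines its number of factors and the sum of \<open>i - 1\<close> over
  its factors \<open>x\<^sub>i\<close>; if at most one factor is \<open>x\<^sub>2\<close>, \<open>x\<^sub>3\<close> or \<open>x\<^sub>4\<close>, then the residue of this sum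
  modulo 4 reveals that factor, and with it the whole monomial. So the map to the semigroup ring is
  injective on the polynomials of weight at most 1, and its kernel is the image of \<open>\<delta>\<^sub>1\<close>
  (\<open>phi_eq_0_iff\<close>).

  Both modules of the theorem, \<open>R/I\<close> and the semigroup ring, are images of \<open>R\<close> under an \<open>R\<close>-linear
  map with this same kernel. The kernel is homogeneous, so the images of the homogeneous components
  of \<open>R\<close> are a grading (locale \<open>graded_cyclic_module\<close>), and one lemma,
  \<open>resolution_of_cyclic_module\<close>, gives both resolutions.
\<close>

abbreviation lookup where "lookup \<equiv> Poly_Mapping.lookup"
abbreviation keys where "keys \<equiv> Poly_Mapping.keys"

section \<open>Homogeneous components\<close>

lemma nscale_add: "nscale (m + n) g = nscale m g + nscale n g"
  by (induction n) (simp_all add: nscale_def algebra_simps)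

lemma nscale_0 [simp]: "nscale 0 g = 0"
  by (simp add: nscale_def)

lemma nscale_1 [simp]: "nscale (Suc 0) g = g"
  by (simp add: nscale_def)

lemma monom_deg_add: "monom_deg w (m + n) = monom_deg w m + monom_deg w n"
  by (simp add: monom_deg_def lookup_add nscale_add sum.distrib)

lemma monom_deg_0 [simp]: "monom_deg w 0 = 0"
  by (simp add: monom_deg_def)

lemma monom_deg_single: "monom_deg w (Poly_Mapping.single i 1) = w i"
proof -
  have "monom_deg w (Poly_Mapping.single i 1) = (\<Sum>j\<in>UNIV. if j = i then w i else 0)"
    unfolding monom_deg_def by (intro sum.cong) (auto simp: lookup_single when_def)
  then show ?thesis by simp
qed

definition hcomp ::
  "('v::finite \<Rightarrow> 'g::comm_monoid_add) \<Rightarrow> 'g \<Rightarrow> ('v, 'k::zero) mpol \<Rightarrow> ('v, 'k) mpol" where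
  "hcomp w g f = Abs_poly_mapping (\<lambda>m. lookup f m when monom_deg w m = g)"

lemma lookup_hcomp: "lookup (hcomp w g f) m = (lookup f m when monom_deg w m = g)"
proof -
  have "finite {m. (lookup f m when monom_deg w m = g) \<noteq> 0}"
    by (rule finite_subset[OF _ finite_lookup[of f]]) auto
  then show ?thesis unfolding hcomp_def by simp
qed

lemma keys_hcomp: "keys (hcomp w g f) = {m \<in> keys f. monom_deg w m = g}"
  by (auto simp: in_keys_iff lookup_hcomp)

lemma hcomp_in_homog_comp [simp]: "hcomp w g f \<in> homog_comp w g"
  by (auto simp: homog_comp_def keys_hcomp)

lemma hcomp_0 [simp]: "hcomp w g 0 = 0"
  by (rule poly_mapping_eqI) (simp add: lookup_hcomp)

lemma hcomp_add: "hcomp w g (f + f') = hcomp w g f + hcomp w g f'"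
  by (rule poly_mapping_eqI) (simp add: lookup_hcomp lookup_add when_add_distrib)

lemma hcomp_diff:
  "hcomp w g (f - f') = hcomp w g f - hcomp w g (f' :: ('v::finite, 'k::ab_group_add) mpol)"
  by (rule poly_mapping_eqI) (simp add: lookup_hcomp lookup_minus when_diff_distrib)

lemma hcomp_uminus:
  "hcomp w g (- f) = - hcomp w g (f :: ('v::finite, 'k::ab_group_add) mpol)"
  by (rule poly_mapping_eqI) (simp add: lookup_hcomp when_uminus_distrib)

lemma hcomp_sum: "hcomp w g (\<Sum>i\<in>I. f i) = (\<Sum>i\<in>I. hcomp w g (f i))"
  by (induction I rule: infinite_finite_induct) (simp_all add: hcomp_add)

lemma hcomp_homog:
  assumes "f \<in> homog_comp w h"
  shows "hcomp w g f = (if g = h then f else 0)"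
  using assms
  by (intro poly_mapping_eqI)
     (auto simp: lookup_hcomp homog_comp_def when_def in_keys_iff)

lemma sum_hcomp:
  assumes "finite G" "monom_deg w ` keys f \<subseteq> G"
  shows "(\<Sum>g\<in>G. hcomp w g f) = f"
proof (rule poly_mapping_eqI)
  fix m
  have "lookup (\<Sum>g\<in>G. hcomp w g f) m = (\<Sum>g\<in>G. if g = monom_deg w m then lookup f m else 0)"
    by (simp add: lookup_sum lookup_hcomp when_def eq_commute)
  also have "\<dots> = lookup f m"
    using assms by (cases "m \<in> keys f") (auto simp: in_keys_iff)
  finally show "lookup (\<Sum>g\<in>G. hcomp w g f) m = lookup f m" .
qed

lemma zero_in_homog_comp [simp]: "0 \<in> homog_comp w g"
  by (simp add: homog_comp_def)

lemma add_in_homog_comp: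
  "f \<in> homog_comp w g \<Longrightarrow> f' \<in> homog_comp w g \<Longrightarrow> f + f' \<in> homog_comp w g"
  using keys_add[of f f'] by (auto simp: homog_comp_def)

lemma uminus_in_homog_comp:
  "f \<in> homog_comp w g \<Longrightarrow> - f \<in> homog_comp w (g :: 'g::comm_monoid_add)"
  for f :: "('v::finite, 'k::ab_group_add) mpol"
  by (auto simp: homog_comp_def in_keys_iff)

lemma mult_in_homog_comp:
  fixes f f' :: "('v::finite, 'k::comm_ring_1) mpol"
  assumes "f \<in> homog_comp w g" "f' \<in> homog_comp w h"
  shows "f * f' \<in> homog_comp w (g + h)"
  using assms keys_mult[of f f'] by (fastforce simp: homog_comp_def monom_deg_add)

lemma Var_in_homog_comp: "Var i \<in> homog_comp w (w i)"
  by (simp add: homog_comp_def Var_def monom_deg_single del: One_nat_def)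

text \<open>
  Multiplication by a homogeneous element shifts homogeneous components. Cancellation in the monoid
  of degrees makes sure that no other component of \<open>f\<close> lands in degree \<open>g + h\<close>.
\<close>

lemma hcomp_mult_homog:
  fixes x f :: "('v::finite, 'k::comm_ring_1) mpol" and g h :: "'g::cancel_comm_monoid_add"
  assumes "x \<in> homog_comp w g"
  shows "hcomp w (g + h) (x * f) = x * hcomp w h f"
proof -
  define G where "G = insert h (monom_deg w ` keys f)"
  have G: "finite G" by (simp add: G_def)
  have "hcomp w (g + h) (x * f) = hcomp w (g + h) (x * (\<Sum>h'\<in>G. hcomp w h' f))"
    using sum_hcomp[OF G, of w f] by (simp add: G_def subset_insertI)
  also have "\<dots> = (\<Sum>h'\<in>G. hcomp w (g + h) (x * hcomp w h' f))"
    by (simp add: sum_distrib_left hcomp_sum)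
  also have "\<dots> = (\<Sum>h'\<in>G. if h' = h then x * hcomp w h f else 0)"
    by (intro sum.cong refl)
       (auto simp: hcomp_homog[OF mult_in_homog_comp[OF assms hcomp_in_homog_comp]])
  also have "\<dots> = x * hcomp w h f" using G by (simp add: G_def)
  finally show ?thesis .
qed

lemma hcomp_mult_homog_eq_0:
  fixes x f :: "('v::finite, 'k::comm_ring_1) mpol"
  assumes "x \<in> homog_comp w g" "\<And>h. k \<noteq> g + h"
  shows "hcomp w k (x * f) = 0"
proof -
  define G where "G = monom_deg w ` keys f"
  have "hcomp w k (x * f) = hcomp w k (x * (\<Sum>h'\<in>G. hcomp w h' f))"
    using sum_hcomp[of G w f] by (simp add: G_def)
  also have "\<dots> = (\<Sum>h'\<in>G. hcomp w k (x * hcomp w h' f))"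
    by (simp add: sum_distrib_left hcomp_sum)
  also have "\<dots> = 0"
    by (intro sum.neutral)
       (auto simp: hcomp_homog[OF mult_in_homog_comp[OF assms(1) hcomp_in_homog_comp]] assms(2))
  finally show ?thesis .
qed

definition deg_le :: "('v::finite \<Rightarrow> nat) \<Rightarrow> nat \<Rightarrow> ('v, 'k::zero) mpol \<Rightarrow> bool" where
  "deg_le w n f \<longleftrightarrow> (\<forall>m\<in>keys f. monom_deg w m \<le> n)"

lemma deg_le_0 [simp]: "deg_le w n 0"
  by (simp add: deg_le_def)

lemma deg_le_homog: "f \<in> homog_comp w n \<Longrightarrow> n \<le> n' \<Longrightarrow> deg_le w n' f"
  by (auto simp: deg_le_def homog_comp_def)

lemma deg_le_add: "deg_le w n f \<Longrightarrow> deg_le w n f' \<Longrightarrow> deg_le w n (f + f')"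
  using keys_add[of f f'] by (auto simp: deg_le_def)

lemma deg_le_uminus:
  "deg_le w n f \<Longrightarrow> deg_le w n (- f :: ('v::finite, 'k::ab_group_add) mpol)"
  by (auto simp: deg_le_def in_keys_iff)

lemma deg_le_diff:
  "deg_le w n f \<Longrightarrow> deg_le w n f' \<Longrightarrow> deg_le w n (f - f' :: ('v::finite, 'k::ab_group_add) mpol)"
  using deg_le_add[of w n f "- f'"] deg_le_uminus[of w n f'] by simp

lemma deg_le_sum:
  "(\<And>i. i \<in> I \<Longrightarrow> deg_le w n (f i)) \<Longrightarrow> deg_le w n (\<Sum>i\<in>I. f i)"
  by (induction I rule: infinite_finite_induct) (auto intro: deg_le_add)

lemma deg_le_mult:
  fixes f f' :: "('v::finite, 'k::comm_ring_1) mpol"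
  assumes "deg_le w n f" "deg_le w n' f'"
  shows "deg_le w (n + n') (f * f')"
proof -
  have "monom_deg w m \<le> n + n'" if m: "m \<in> keys (f * f')" for m
  proof -
    obtain p q where "m = p + q" "p \<in> keys f" "q \<in> keys f'" using m keys_mult by blast
    then show ?thesis using assms add_mono by (fastforce simp: deg_le_def monom_deg_add)
  qed
  then show ?thesis by (simp add: deg_le_def)
qed

lemma deg_le_ex: "\<exists>n. deg_le w n f"
proof
  show "deg_le w (Max (monom_deg w ` keys f)) f"
    by (simp add: deg_le_def)
qed

lemma deg_le_if_hcomp_eq_0: "deg_le w (Suc n) f \<Longrightarrow> hcomp w (Suc n) f = 0 \<Longrightarrow> deg_le w n f"
  unfolding deg_le_def
  by (metis (mono_tags, lifting) keys_hcomp keys_zero empty_Collect_eq le_Suc_eq)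

lemma eq_0_if_hcomp_0_eq_0: "deg_le w 0 f \<Longrightarrow> hcomp w 0 f = 0 \<Longrightarrow> f = 0"
  using hcomp_homog[of f w 0 0] by (simp add: deg_le_def homog_comp_def)

text \<open>
  Initial forms are multiplicative: a product of terms reaches the top weight \<open>a + n\<close> only if both
  factors have their top weight. The top component of a factor may be \<open>0\<close>.
\<close>

lemma hcomp_mult_top:
  fixes x f :: "('v::finite, 'k::comm_ring_1) mpol"
  assumes "deg_le w a x" "deg_le w n f"
  shows "hcomp w (a + n) (x * f) = hcomp w a x * hcomp w n f"
proof -
  define x' where "x' = x - hcomp w a x"
  have x: "x = hcomp w a x + x'" by (simp add: x'_def)
  have lt: "monom_deg w p < a" if "p \<in> keys x'" for p
  proof -
    have "monom_deg w p \<noteq> a" "p \<in> keys x"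
      using that
        by (auto simp: x'_def in_keys_iff lookup_minus lookup_hcomp when_def split: if_splits)
    then show ?thesis using assms(1) by (auto simp: deg_le_def le_less)
  qed
  have "m \<notin> keys (x' * f)" if "monom_deg w m = a + n" for m
  proof
    assume "m \<in> keys (x' * f)"
    then obtain p q where "m = p + q" "p \<in> keys x'" "q \<in> keys f" using keys_mult by blast
    then show False using lt[of p] assms(2) that by (fastforce simp: deg_le_def monom_deg_add)
  qed
  then have "keys (hcomp w (a + n) (x' * f)) = {}" by (auto simp: keys_hcomp)
  then have "hcomp w (a + n) (x' * f) = 0" by (simp del: One_nat_def)
  moreover have "x * f = hcomp w a x * f + x' * f"
    by (subst x) (simp only: distrib_right)
  ultimately show ?thesis
    by (simp add: hcomp_add hcomp_mult_homog)
qed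

section \<open>Monomial ideals generated by variables\<close>

text \<open>
  The ideal generated by the variables in \<open>V\<close>. Membership is a condition on each monomial
  separately, which makes it easy to cancel variables outside \<open>V\<close>.
\<close>

definition var_ideal :: "'v set \<Rightarrow> ('v, 'k::zero) mpol set" where
  "var_ideal V = {f. \<forall>m\<in>keys f. \<exists>i\<in>V. lookup m i \<noteq> 0}"

lemma var_ideal_empty [simp]: "f \<in> var_ideal {} \<longleftrightarrow> f = 0"
  by (auto simp: var_ideal_def)

lemma var_ideal_add: "f \<in> var_ideal V \<Longrightarrow> f' \<in> var_ideal V \<Longrightarrow> f + f' \<in> var_ideal V"
  using keys_add[of f f'] by (auto simp: var_ideal_def)

lemma var_ideal_mult: "f \<in> var_ideal V \<Longrightarrow> f * f' \<in> var_ideal V"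
  for f f' :: "('v, 'k::comm_ring_1) mpol"
  using keys_mult[of f f'] by (fastforce simp: var_ideal_def lookup_add)

lemma Var_in_var_ideal: "i \<in> V \<Longrightarrow> Var i \<in> var_ideal V"
  by (auto simp: var_ideal_def Var_def intro!: bexI[of _ i])

lemma lookup_single_mult: "lookup (Poly_Mapping.single p 1 * f) (p + m) = lookup f m"
  for f :: "'a::cancel_comm_monoid_add \<Rightarrow>\<^sub>0 'k::comm_ring_1"
  by (simp add: lookup_mult lookup_single when_mult)

text \<open>
  The variable \<open>k\<close> is a nonzerodivisor modulo the variables in \<open>V\<close>, because multiplying a monomial
  by it does not change the exponents of the variables in \<open>V\<close>. For \<open>V = {}\<close> this says that variables
  are nonzerodivisors.
\<close>

lemma var_ideal_cancel:
  fixes f :: "('v, 'k::comm_ring_1) mpol"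
  assumes "Var k * f \<in> var_ideal V" "k \<notin> V"
  shows "f \<in> var_ideal V"
  unfolding var_ideal_def
proof (standard, standard)
  fix m assume "m \<in> keys f"
  then have "Poly_Mapping.single k 1 + m \<in> keys (Var k * f)"
    by (simp add: in_keys_iff Var_def lookup_single_mult del: One_nat_def)
  then obtain i where "i \<in> V" "lookup (Poly_Mapping.single k 1 + m) i \<noteq> 0"
    using assms(1) unfolding var_ideal_def by blast
  then show "\<exists>i\<in>V. lookup m i \<noteq> 0"
    using assms(2) by (metis lookup_add lookup_single_not_eq add_0)
qed

lemma Var_mult_in_var_ideal_iff:
  "k \<notin> V \<Longrightarrow> Var k * f \<in> var_ideal V \<longleftrightarrow> f \<in> var_ideal V"
  for f :: "('v, 'k::comm_ring_1) mpol"
  using var_ideal_cancel[of k f V] var_ideal_mult[of f V "Var k"] by (auto simp: mult.commute)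

text \<open>
  Split off the monomials of \<open>f\<close> that \<open>Var k\<close> divides. Iterating this expresses membership in
  \<open>var_ideal\<close> by cofactors.
\<close>

lemma var_ideal_insertE:
  fixes f :: "('v, 'k::comm_ring_1) mpol"
  assumes "f \<in> var_ideal (insert k V)"
  obtains g h where "f = Var k * g + h" "h \<in> var_ideal V"
proof -
  define p where "p = Poly_Mapping.single k (1::nat)"
  define g where "g = Poly_Mapping.map_key ((+) p) f"
  have g: "lookup g m = lookup f (p + m)" for m
    unfolding g_def by (subst map_key.rep_eq) (auto intro: injI)
  define h where "h = f - Var k * g"
  have "h \<in> var_ideal V"
    unfolding var_ideal_def
  proof (standard, standard)
    fix m assume m: "m \<in> keys h"
    have "lookup m k = 0"
    proof (rule ccontr)
      assume "lookup m k \<noteq> 0"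
      then have "m = p + (m - p)"
        by (intro poly_mapping_eqI) (auto simp: p_def lookup_add lookup_minus lookup_single when_def)
      then obtain m' where "m = p + m'" by blast
      then have "lookup h m = 0"
        by (simp add: h_def lookup_minus Var_def lookup_single_mult g flip: p_def del: One_nat_def)
      then show False using m by auto
    qed
    then have "m \<notin> keys (Var k * g)"
      using keys_mult[of "Var k :: ('v, 'k) mpol" g]
      by (fastforce simp: Var_def lookup_add split: if_splits)
    then have "m \<in> keys f"
      using m by (auto simp: h_def in_keys_iff lookup_minus)
    then show "\<exists>i\<in>V. lookup m i \<noteq> 0"
      using assms \<open>lookup m k = 0\<close> by (auto simp: var_ideal_def)
  qed
  then show ?thesis using that[of g h] by (simp add: h_def)
qed

lemma Var_mult_eq_0: "Var k * f = 0 \<Longrightarrow> f = 0"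
  for f :: "('v, 'k::comm_ring_1) mpol"
  using var_ideal_cancel[of k f "{}"] by simp

lemma Var_mult_cancel: "Var k * f = Var k * f' \<longleftrightarrow> f = f'"
  for f f' :: "('v, 'k::comm_ring_1) mpol"
  using Var_mult_eq_0[of k "f - f'"] by (auto simp: algebra_simps)

lemma var_ideal_singletonE:
  fixes f :: "('v, 'k::comm_ring_1) mpol"
  assumes "f \<in> var_ideal {k}"
  obtains g where "f = Var k * g"
  using var_ideal_insertE[OF assms] by auto

text \<open>
  Distinct variables form a regular sequence, so all syzygies between them are multiples of the
  trivial one.
\<close>

lemma Var_mult_eq_Var_multE:
  fixes f g :: "('v, 'k::comm_ring_1) mpol"
  assumes "Var i * f = Var j * g" "i \<noteq> j"
  obtains c where "f = Var j * c" "g = Var i * c"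
proof -
  have "Var i * f \<in> var_ideal {j}"
    using assms(1) by (simp add: Var_in_var_ideal var_ideal_mult)
  then have "f \<in> var_ideal {j}" using assms(2) by (auto intro: var_ideal_cancel)
  then obtain c where c: "f = Var j * c" by (rule var_ideal_singletonE)
  with assms(1) have "Var j * (Var i * c) = Var j * g" by (simp add: ac_simps)
  then have "g = Var i * c" by (simp add: Var_mult_cancel)
  with c show ?thesis by (rule that)
qed

section \<open>Exactness from leading forms\<close>

lemma mult_mat_vec_nth:
  "A \<in> carrier_mat n m \<Longrightarrow> v \<in> carrier_vec m \<Longrightarrow> i < n \<Longrightarrow>
    (A *\<^sub>v v) $ i = (\<Sum>j<m. A $$ (i, j) * v $ j)"
  by (auto simp: scalar_prod_def lessThan_atLeast0)

abbreviation leading_mat ::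
  "('v::finite \<Rightarrow> nat) \<Rightarrow> nat \<Rightarrow> ('v, 'k::comm_ring_1) mpol mat \<Rightarrow> ('v, 'k) mpol mat" where
  "leading_mat w b B \<equiv> map_mat (hcomp w b) B"

text \<open>
  If the top component of \<open>v\<close> is a boundary of the leading matrix, then subtracting a boundary of \<open>B\<close>
  itself kills that component and creates no terms of higher weight.
\<close>

lemma cancel_top_component:
  fixes B :: "('v::finite, 'k::comm_ring_1) mpol mat"
  assumes B: "B \<in> carrier_mat m p"
    and deg_B: "\<And>i j. i < m \<Longrightarrow> j < p \<Longrightarrow> deg_le w b (B $$ (i, j))"
    and v: "v \<in> carrier_vec m"
    and deg_v: "\<And>i. i < m \<Longrightarrow> deg_le w N (v $ i)"
    and u: "u \<in> carrier_vec p" "map_vec (hcomp w N) v = leading_mat w b B *\<^sub>v u"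
  obtains u' where "u' \<in> carrier_vec p" "\<And>i. i < m \<Longrightarrow> deg_le w N ((v - B *\<^sub>v u') $ i)"
    "\<And>i. i < m \<Longrightarrow> hcomp w N ((v - B *\<^sub>v u') $ i) = 0"
proof -
  have top: "hcomp w N (v $ i) = (\<Sum>j<p. hcomp w N (hcomp w b (B $$ (i, j)) * u $ j))"
    if i: "i < m" for i
  proof -
    have "hcomp w N (v $ i) = (leading_mat w b B *\<^sub>v u) $ i"
      using v i by (simp flip: u(2))
    also have "\<dots> = (\<Sum>j<p. hcomp w b (B $$ (i, j)) * u $ j)"
      using B u(1) i by (subst mult_mat_vec_nth[where m = p and n = m]) auto
    finally have "hcomp w N (v $ i) = (\<Sum>j<p. hcomp w b (B $$ (i, j)) * u $ j)" .
    then have "hcomp w N (hcomp w N (v $ i)) = hcomp w N (\<Sum>j<p. hcomp w b (B $$ (i, j)) * u $ j)"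
      by simp
    then show ?thesis by (simp add: hcomp_homog[OF hcomp_in_homog_comp] hcomp_sum)
  qed
  show ?thesis
  proof (cases "b \<le> N")
    case True
    then have N: "N = b + (N - b)" by simp
    \<comment> \<open>The other components of \<open>u\<close> contribute nothing in weight \<open>N\<close> to the leading product, but
        would put unwanted terms into \<open>B *\<^sub>v u\<close>.\<close>
    define u' where "u' = map_vec (hcomp w (N - b)) u"
    have u': "u' \<in> carrier_vec p" using u(1) by (simp add: u'_def)
    have deg_u': "deg_le w (N - b) (u' $ j)" if "j < p" for j
      using that u(1) by (auto simp: u'_def intro: deg_le_homog[OF hcomp_in_homog_comp])
    have nth: "(v - B *\<^sub>v u') $ i = v $ i - (\<Sum>j<p. B $$ (i, j) * u' $ j)"
      if "i < m" for i
      using that B v u' mult_mat_vec_nth[OF B u' that] by auto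
    have term_deg: "deg_le w N (B $$ (i, j) * u' $ j)" if "i < m" "j < p" for i j
      using deg_le_mult[OF deg_B deg_u', of i j j] that True by simp
    show ?thesis
    proof
      show "u' \<in> carrier_vec p" by (fact u')
    next
      fix i assume i: "i < m"
      show "deg_le w N ((v - B *\<^sub>v u') $ i)"
        unfolding nth[OF i] using i deg_v term_deg by (auto intro!: deg_le_diff deg_le_sum)
      have "hcomp w N (B $$ (i, j) * u' $ j) = hcomp w N (hcomp w b (B $$ (i, j)) * u $ j)"
        if j: "j < p" for j
      proof -
        have "hcomp w N (B $$ (i, j) * u' $ j) = hcomp w b (B $$ (i, j)) * hcomp w (N - b) (u' $ j)"
          using hcomp_mult_top[OF deg_B[OF i j] deg_u'[OF j]] N by simp
        also have "\<dots> = hcomp w b (B $$ (i, j)) * hcomp w (N - b) (u $ j)"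
          using j u(1) by (simp add: u'_def hcomp_homog[OF hcomp_in_homog_comp])
        also have "\<dots> = hcomp w N (hcomp w b (B $$ (i, j)) * u $ j)"
          using hcomp_mult_homog[OF hcomp_in_homog_comp, of w b "N - b" "B $$ (i, j)" "u $ j"] N by simp
        finally show ?thesis .
      qed
      then show "hcomp w N ((v - B *\<^sub>v u') $ i) = 0"
        by (simp add: nth[OF i] hcomp_diff hcomp_sum top[OF i])
    qed
  next
    case False
    \<comment> \<open>The entries of the leading matrix have weight \<open>b > N\<close>, so \<open>v\<close> has no component of weight \<open>N\<close>.\<close>
    have "hcomp w N (v $ i) = 0" if "i < m" for i
      unfolding top[OF that] using False
      by (intro sum.neutral ballI hcomp_mult_homog_eq_0[OF hcomp_in_homog_comp]) auto
    moreover have "v - B *\<^sub>v 0\<^sub>v p = v" using B v by auto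
    ultimately show ?thesis using deg_v by (intro that[of "0\<^sub>v p"]) auto
  qed
qed

lemma vec_deg_le_ex: "\<exists>n. \<forall>i<m. deg_le w n (v $ i)"
proof (induction m)
  case (Suc m)
  then obtain n where n: "\<forall>i<m. deg_le w n (v $ i)" by blast
  obtain n' where "deg_le w n' (v $ m)" using deg_le_ex by blast
  with n have "\<forall>i<Suc m. deg_le w (max n n') (v $ i)"
    by (fastforce simp: less_Suc_eq deg_le_def)
  then show ?case by blast
qed simp

text \<open>
  Exactness lifts from leading forms: induction on a bound for the weight of a cycle, each step
  removing the top component with \<open>cancel_top_component\<close>. The leading matrices are taken at the
  common weights \<open>a\<close> and \<open>b\<close>; entries of smaller weight are replaced by \<open>0\<close>.
\<close>

lemma mat_kernel_eq_mat_image_by_leading_forms: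
  fixes A B :: "('v::finite, 'k::comm_ring_1) mpol mat"
  assumes A: "A \<in> carrier_mat n m" and B: "B \<in> carrier_mat m p"
    and AB: "A * B = 0\<^sub>m n p"
    and deg_A: "\<And>i j. i < n \<Longrightarrow> j < m \<Longrightarrow> deg_le w a (A $$ (i, j))"
    and deg_B: "\<And>i j. i < m \<Longrightarrow> j < p \<Longrightarrow> deg_le w b (B $$ (i, j))"
    and lead: "\<And>v. v \<in> carrier_vec m \<Longrightarrow> leading_mat w a A *\<^sub>v v = 0\<^sub>v n \<Longrightarrow>
      \<exists>u\<in>carrier_vec p. v = leading_mat w b B *\<^sub>v u"
  shows "mat_kernel A = mat_image B"
proof
  have AB0: "A *\<^sub>v (B *\<^sub>v u) = 0\<^sub>v n" if "u \<in> carrier_vec p" for u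
    unfolding assoc_mult_mat_vec[OF A B that, symmetric] AB using that by (intro eq_vecI) auto
  then show "mat_image B \<subseteq> mat_kernel A"
    using A B by (auto simp: mat_image_def mat_kernel_def)
  have step: "\<exists>u. u \<in> carrier_vec p \<and> (\<forall>i<m. deg_le w N ((v - B *\<^sub>v u) $ i)) \<and>
      (\<forall>i<m. hcomp w N ((v - B *\<^sub>v u) $ i) = 0)"
    if v: "v \<in> carrier_vec m" "A *\<^sub>v v = 0\<^sub>v n" and deg_v: "\<And>i. i < m \<Longrightarrow> deg_le w N (v $ i)" for v N
  proof -
    have "leading_mat w a A *\<^sub>v map_vec (hcomp w N) v = 0\<^sub>v n"
    proof (rule eq_vecI)
      fix i assume "i < dim_vec (0\<^sub>v n :: ('v, 'k) mpol vec)"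
      then have i: "i < n" by simp
      have "(leading_mat w a A *\<^sub>v map_vec (hcomp w N) v) $ i =
          (\<Sum>j<m. hcomp w a (A $$ (i, j)) * hcomp w N (v $ j))"
        using A v i by (subst mult_mat_vec_nth[where m = m and n = n]) auto
      also have "\<dots> = (\<Sum>j<m. hcomp w (a + N) (A $$ (i, j) * v $ j))"
        using i by (intro sum.cong refl) (simp add: hcomp_mult_top deg_A deg_v)
      also have "\<dots> = hcomp w (a + N) ((A *\<^sub>v v) $ i)"
        by (simp add: mult_mat_vec_nth[OF A v(1) i] hcomp_sum)
      also have "\<dots> = 0" using i by (simp add: v(2))
      finally show "(leading_mat w a A *\<^sub>v map_vec (hcomp w N) v) $ i = 0\<^sub>v n $ i"
        using i by simp
    qed (use A in simp)
    then obtain u where "u \<in> carrier_vec p" "map_vec (hcomp w N) v = leading_mat w b B *\<^sub>v u"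
      using lead[of "map_vec (hcomp w N) v"] v(1) by auto
    from cancel_top_component[OF B deg_B v(1) deg_v this] show ?thesis by metis
  qed
  have add_back: "v \<in> mat_image B"
    if v: "v \<in> carrier_vec m" and u: "u \<in> carrier_vec p" and im: "v - B *\<^sub>v u \<in> mat_image B" for v u
  proof -
    obtain u' where u': "u' \<in> carrier_vec p" "v - B *\<^sub>v u = B *\<^sub>v u'"
      using im B by (auto simp: mat_image_def)
    have "v = B *\<^sub>v u' + B *\<^sub>v u"
      unfolding u'(2)[symmetric] using v u B by auto
    also have "\<dots> = B *\<^sub>v (u' + u)"
      using mult_add_distrib_mat_vec[OF B u'(1) u] by simp
    finally show ?thesis using u'(1) u B by (auto simp: mat_image_def)
  qed
  have *: "v \<in> mat_image B"
    if "v \<in> carrier_vec m" "A *\<^sub>v v = 0\<^sub>v n" "\<And>i. i < m \<Longrightarrow> deg_le w N (v $ i)" for v N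
    using that
  proof (induction N arbitrary: v)
    case (0 v)
    obtain u where u: "u \<in> carrier_vec p" "\<forall>i<m. deg_le w 0 ((v - B *\<^sub>v u) $ i)"
      "\<forall>i<m. hcomp w 0 ((v - B *\<^sub>v u) $ i) = 0"
      using step[OF "0.prems"] by blast
    have "v - B *\<^sub>v u = B *\<^sub>v 0\<^sub>v p"
    proof (rule eq_vecI)
      fix i assume "i < dim_vec (B *\<^sub>v 0\<^sub>v p)"
      then have i: "i < m" using B by simp
      then have "(v - B *\<^sub>v u) $ i = 0" using u(2,3) eq_0_if_hcomp_0_eq_0 by blast
      then show "(v - B *\<^sub>v u) $ i = (B *\<^sub>v 0\<^sub>v p) $ i" using i B by simp
    qed (use B in simp)
    then have "v - B *\<^sub>v u \<in> mat_image B" using B by (auto simp: mat_image_def)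
    then show ?case using add_back "0.prems"(1) u(1) by blast
  next
    case (Suc N v)
    obtain u where u: "u \<in> carrier_vec p" "\<forall>i<m. deg_le w (Suc N) ((v - B *\<^sub>v u) $ i)"
      "\<forall>i<m. hcomp w (Suc N) ((v - B *\<^sub>v u) $ i) = 0"
      using step[OF Suc.prems] by blast
    have Bu: "B *\<^sub>v u \<in> carrier_vec m" using B u(1) by simp
    have "A *\<^sub>v (v - B *\<^sub>v u) = 0\<^sub>v n"
      using mult_minus_distrib_mat_vec[OF A Suc.prems(1) Bu] Suc.prems(2) AB0[OF u(1)] by simp
    then have "v - B *\<^sub>v u \<in> mat_image B"
    proof (intro Suc.IH)
      fix i assume "i < m"
      then show "deg_le w N ((v - B *\<^sub>v u) $ i)" using u(2,3) deg_le_if_hcomp_eq_0 by blast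
    qed (use Bu Suc.prems(1) in auto)
    then show ?case using add_back Suc.prems(1) u(1) by blast
  qed
  show "mat_kernel A \<subseteq> mat_image B"
  proof
    fix v assume "v \<in> mat_kernel A"
    then have v: "v \<in> carrier_vec m" "A *\<^sub>v v = 0\<^sub>v n" using mat_kernelD[OF A] by auto
    obtain N where "\<forall>i<m. deg_le w N (v $ i)" using vec_deg_le_ex by blast
    then show "v \<in> mat_image B" using * v by blast
  qed
qed

section \<open>Syzygies of the square of the ideal of the middle variables\<close>

text \<open>
  Reduces the derivation of one equation from another to a ring identity.
\<close>

lemma eq_if_same_diff: "a = b \<Longrightarrow> c - d = a - b \<Longrightarrow> c = (d :: 'a::group_add)"
  by simp

text \<open>
  First syzygies of the six products of two of \<open>x\<^sub>2\<close>, \<open>x\<^sub>3\<close>, \<open>x\<^sub>4\<close>. The coefficients are eliminated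
  one after the other: in the order \<open>v6\<close>, \<open>v3\<close>, \<open>v2\<close>, \<open>v1\<close>, each, corrected by the earlier
  choices, lies in the ideal of some of the variables, because the other terms of the relation do,
  and is therefore a combination of columns of
  the leading matrix of \<open>\<delta>\<^sub>2\<close>. What remains is a relation \<open>x\<^sub>2 p = x\<^sub>3 q\<close>.
\<close>

lemma syzygies_of_quadrics:
  fixes v1 v2 v3 v4 v5 v6 :: "(var5, 'k::comm_ring_1) mpol"
  assumes eq: "x2^2 * v1 + x2 * x3 * v2 + x3^2 * v3 + x2 * x4 * v4 + x3 * x4 * v5 + x4^2 * v6 = 0"
  obtains u1 u2 u3 u4 u5 u6 u7 u8 where
    "v1 = - x3 * u1 - x4 * u3" "v2 = x2 * u1 - x3 * u2 - x4 * u4" "v3 = x2 * u2 - x4 * u6"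
    "v4 = x2 * u3 + x3 * u4 - x3 * u5 - x4 * u7" "v5 = x2 * u5 + x3 * u6 - x4 * u8"
    "v6 = x2 * u7 + x3 * u8"
proof -
  have mem: "Var i * f \<in> var_ideal V" if "i \<in> V" for i V and f :: "(var5, 'k) mpol"
    using that by (intro var_ideal_mult Var_in_var_ideal)
  have mem2: "Var i * f + Var j * g \<in> var_ideal V" if "i \<in> V" "j \<in> V"
    for i j V and f g :: "(var5, 'k) mpol"
    using that by (intro var_ideal_add mem)
  have "x4 * (x4 * v6) = x2 * (- x2 * v1 - x3 * v2 - x4 * v4) + x3 * (- x3 * v3 - x4 * v5)"
    by (rule eq_if_same_diff[OF eq]) (simp add: algebra_simps power2_eq_square)
  then have "x4 * (x4 * v6) \<in> var_ideal {V2, V3}" by (simp only:) (rule mem2; simp)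
  then have "v6 \<in> var_ideal {V2, V3}" by (simp add: Var_mult_in_var_ideal_iff)
  then obtain u7 u8 where v6: "v6 = x2 * u7 + x3 * u8"
    by (metis var_ideal_insertE var_ideal_singletonE)
  have "x3 * (x3 * v3) = x2 * (- x2 * v1 - x3 * v2 - x4 * v4) + x4 * (- x3 * v5 - x4 * v6)"
    by (rule eq_if_same_diff[OF eq]) (simp add: algebra_simps power2_eq_square)
  then have "x3 * (x3 * v3) \<in> var_ideal {V2, V4}" by (simp only:) (rule mem2; simp)
  then have "v3 \<in> var_ideal {V2, V4}" by (simp add: Var_mult_in_var_ideal_iff)
  then obtain u2 u6' where v3: "v3 = x2 * u2 + x4 * u6'"
    by (metis var_ideal_insertE var_ideal_singletonE)
  \<comment> \<open>The sign of \<open>u6\<close> is that of the column of \<open>\<delta>\<^sub>2\<close>; likewise for \<open>u4\<close> and \<open>u3\<close> below.\<close>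
  define u6 where "u6 = - u6'"
  have "x2 * (x2 * v1 + x3 * (v2 + x3 * u2)) = x4 * (- x2 * v4 - x3 * v5 - x4 * v6 - x3^2 * u6')"
    by (rule eq_if_same_diff[OF eq[unfolded v3]]) (simp add: algebra_simps power2_eq_square)
  then have "x2 * (x2 * v1 + x3 * (v2 + x3 * u2)) \<in> var_ideal {V4}"
    by (simp only:) (rule mem; simp)
  then have "x2 * v1 + x3 * (v2 + x3 * u2) \<in> var_ideal {V4}"
    by (simp add: Var_mult_in_var_ideal_iff)
  then obtain q where q: "x2 * v1 + x3 * (v2 + x3 * u2) = x4 * q" by (rule var_ideal_singletonE)
  have "x3 * (v2 + x3 * u2) = x2 * (- v1) + x4 * q"
    by (rule eq_if_same_diff[OF q]) (simp add: algebra_simps)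
  then have "x3 * (v2 + x3 * u2) \<in> var_ideal {V2, V4}" by (simp only:) (rule mem2; simp)
  then have "v2 + x3 * u2 \<in> var_ideal {V2, V4}" by (simp add: Var_mult_in_var_ideal_iff)
  then obtain u1 u4' where v2': "v2 + x3 * u2 = x2 * u1 + x4 * u4'"
    by (metis var_ideal_insertE var_ideal_singletonE)
  define u4 where "u4 = - u4'"
  have "x2 * (v1 + x3 * u1) = x4 * (q - x3 * u4')"
    by (rule eq_if_same_diff[OF q[unfolded v2']]) (simp add: algebra_simps power2_eq_square)
  then obtain u3' where v1: "v1 + x3 * u1 = x4 * u3'" "q - x3 * u4' = x2 * u3'"
    by (auto elim: Var_mult_eq_Var_multE)
  define u3 where "u3 = - u3'"
  have v1_eq: "v1 = x4 * u3' - x3 * u1" and v2_eq: "v2 = x2 * u1 + x4 * u4' - x3 * u2"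
    using v1(1) v2' by (simp_all add: algebra_simps)
  have "x4 * (x2 * (v4 + x4 * u7 - x3 * u4 - x2 * u3)) = x4 * (x3 * (x3 * u6 - v5 - x4 * u8))"
    unfolding u6_def u4_def u3_def
    by (rule eq_if_same_diff[OF eq[unfolded v1_eq v2_eq v3 v6]]) (simp add: algebra_simps power2_eq_square)
  then have "x2 * (v4 + x4 * u7 - x3 * u4 - x2 * u3) = x3 * (x3 * u6 - v5 - x4 * u8)"
    by (simp only: Var_mult_cancel)
  \<comment> \<open>The witness for \<open>u5\<close> is \<open>- c\<close>.\<close>
  then obtain c where c: "v4 + x4 * u7 - x3 * u4 - x2 * u3 = x3 * c" "x3 * u6 - v5 - x4 * u8 = x2 * c"
    by (rule Var_mult_eq_Var_multE) simp
  show ?thesis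
  proof
    show "v1 = - x3 * u1 - x4 * u3" by (simp add: v1_eq u3_def)
    show "v2 = x2 * u1 - x3 * u2 - x4 * u4" by (simp add: v2_eq u4_def)
    show "v3 = x2 * u2 - x4 * u6" by (simp add: v3 u6_def)
    show "v4 = x2 * u3 + x3 * u4 - x3 * (- c) - x4 * u7"
      by (rule eq_if_same_diff[OF c(1)]) (simp add: algebra_simps)
    show "v5 = x2 * (- c) + x3 * u6 - x4 * u8"
      by (rule eq_if_same_diff[OF c(2)[symmetric]]) (simp add: algebra_simps)
    show "v6 = x2 * u7 + x3 * u8" by (fact v6)
  qed
qed

text \<open>
  The relations are rows of the leading matrix of \<open>\<delta>\<^sub>2\<close>, and \<open>c\<close>, \<open>f\<close>, \<open>e\<close> are the coefficients of
  the three columns of the leading matrix of \<open>\<delta>\<^sub>3\<close>. The first and the last row involve two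
  unknowns only and yield \<open>c\<close> and \<open>e\<close>; the second row then yields \<open>f\<close>.
\<close>

lemma second_syzygies_of_quadrics:
  fixes v1 v2 v3 v4 v5 v6 v7 v8 :: "(var5, 'k::comm_ring_1) mpol"
  assumes "- x3 * v1 - x4 * v3 = 0" "x2 * v1 - x3 * v2 - x4 * v4 = 0" "x2 * v2 - x4 * v6 = 0"
    "x2 * v3 + x3 * v4 - x3 * v5 - x4 * v7 = 0" "x2 * v7 + x3 * v8 = 0"
  obtains c f e where "v1 = x4 * c" "v2 = x4 * f" "v3 = - x3 * c" "v4 = x2 * c - x3 * f"
    "v5 = - x3 * f + x4 * e" "v6 = x2 * f" "v7 = - x3 * e" "v8 = x2 * e"
proof -
  have "x3 * v1 = x4 * (- v3)"
    by (rule eq_if_same_diff[OF assms(1)[symmetric]]) (simp add: algebra_simps)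
  then obtain c where c: "v1 = x4 * c" "- v3 = x3 * c" by (rule Var_mult_eq_Var_multE) simp
  have "x3 * v8 = x2 * (- v7)" by (rule eq_if_same_diff[OF assms(5)]) (simp add: algebra_simps)
  then obtain e where e: "v8 = x2 * e" "- v7 = x3 * e" by (rule Var_mult_eq_Var_multE) simp
  have v3: "v3 = - x3 * c" by (rule eq_if_same_diff[OF c(2)[symmetric]]) simp
  have v7: "v7 = - x3 * e" by (rule eq_if_same_diff[OF e(2)[symmetric]]) simp
  have "x3 * v2 = x4 * (x2 * c - v4)"
    by (rule eq_if_same_diff[OF assms(2)[unfolded c(1), symmetric]]) (simp add: algebra_simps)
  then obtain f where f: "v2 = x4 * f" "x2 * c - v4 = x3 * f" by (rule Var_mult_eq_Var_multE) simp
  have v4: "v4 = x2 * c - x3 * f"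
    by (rule eq_if_same_diff[OF f(2)[symmetric]]) (simp add: algebra_simps)
  have "x4 * v6 = x4 * (x2 * f)"
    by (rule eq_if_same_diff[OF assms(3)[unfolded f(1), symmetric]]) (simp add: algebra_simps)
  then have v6: "v6 = x2 * f" by (simp only: Var_mult_cancel)
  have "x3 * v5 = x3 * (- x3 * f + x4 * e)"
    by (rule eq_if_same_diff[OF assms(4)[unfolded v3 v4 v7, symmetric]]) (simp add: algebra_simps)
  then have v5: "v5 = - x3 * f + x4 * e" by (simp only: Var_mult_cancel)
  show ?thesis by (rule that) (fact c(1) f(1) v3 v4 v5 v6 v7 e(1))+
qed

section \<open>Exactness at the free modules of positive homological degree\<close>

lemma all_less_3_6_8:
  "(\<forall>i<(3::nat). P i) \<longleftrightarrow> P 0 \<and> P 1 \<and> P 2"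
  "(\<forall>i<(6::nat). P i) \<longleftrightarrow> P 0 \<and> P 1 \<and> P 2 \<and> P 3 \<and> P 4 \<and> P 5"
  "(\<forall>i<(8::nat). P i) \<longleftrightarrow> P 0 \<and> P 1 \<and> P 2 \<and> P 3 \<and> P 4 \<and> P 5 \<and> P 6 \<and> P 7"
proof -
  have "{..<3::nat} = {0, 1, 2}" "{..<6::nat} = {0, 1, 2, 3, 4, 5}"
    "{..<8::nat} = {0, 1, 2, 3, 4, 5, 6, 7}"
    by (auto simp: lessThan_nat_numeral)
  moreover have "(\<forall>i<n. P i) \<longleftrightarrow> (\<forall>i\<in>{..<n}. P i)" for n by auto
  ultimately show
    "(\<forall>i<(3::nat). P i) \<longleftrightarrow> P 0 \<and> P 1 \<and> P 2"
    "(\<forall>i<(6::nat). P i) \<longleftrightarrow> P 0 \<and> P 1 \<and> P 2 \<and> P 3 \<and> P 4 \<and> P 5"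
    "(\<forall>i<(8::nat). P i) \<longleftrightarrow> P 0 \<and> P 1 \<and> P 2 \<and> P 3 \<and> P 4 \<and> P 5 \<and> P 6 \<and> P 7"
    by simp_all
qed

lemma sum_less_3_6_8:
  "(\<Sum>i<(3::nat). f i) = f 0 + f 1 + f 2"
  "(\<Sum>i<(6::nat). f i) = f 0 + f 1 + f 2 + f 3 + f 4 + f 5"
  "(\<Sum>i<(8::nat). f i) = f 0 + f 1 + f 2 + f 3 + f 4 + f 5 + f 6 + f 7"
  by (simp_all add: numeral_eq_Suc)

lemma mat_of_rows_list_in_carrier: "length rs = k \<Longrightarrow> mat_of_rows_list n rs \<in> carrier_mat k n"
  unfolding mat_of_rows_list_def by auto

lemma delta_carrier [simp]:
  "delta1 \<in> carrier_mat 1 6" "delta2 \<in> carrier_mat 6 8" "delta3 \<in> carrier_mat 8 3"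
  unfolding delta1_def delta2_def delta3_def
  by (rule mat_of_rows_list_in_carrier, simp only: list.size)+

lemma mult_mat_nth:
  "A \<in> carrier_mat n m \<Longrightarrow> B \<in> carrier_mat m p \<Longrightarrow> i < n \<Longrightarrow> j < p \<Longrightarrow>
    (A * B) $$ (i, j) = (\<Sum>k<m. A $$ (i, k) * B $$ (k, j))"
  by (auto simp: scalar_prod_def lessThan_atLeast0)

lemma mat_of_rows_list_nth:
  "i < length rs \<Longrightarrow> j < n \<Longrightarrow> mat_of_rows_list n rs $$ (i, j) = rs ! i ! j"
  by (simp add: mat_of_rows_list_def)

lemma delta2_mult_delta3: "delta2 * delta3 = (0\<^sub>m 6 3 :: (var5, 'k::comm_ring_1) mpol mat)"
proof (rule eq_matI)
  fix i j assume "i < dim_row (0\<^sub>m 6 3 :: (var5, 'k) mpol mat)" "j < dim_col (0\<^sub>m 6 3 :: (var5, 'k) mpol mat)"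
  then have ij: "i < 6" "j < 3" by simp_all
  have "\<forall>i<6. \<forall>j<3. (\<Sum>k<8. delta2 $$ (i, k) * delta3 $$ (k, j)) = (0 :: (var5, 'k) mpol)"
    unfolding all_less_3_6_8 sum_less_3_6_8
    by (simp add: delta2_def delta3_def mat_of_rows_list_nth)
  then show "(delta2 * delta3) $$ (i, j) = (0\<^sub>m 6 3 :: (var5, 'k) mpol mat) $$ (i, j)"
    unfolding mult_mat_nth[OF delta_carrier(2,3) ij] using ij by simp
qed (simp_all add: carrier_matD[OF delta_carrier(2)] carrier_matD[OF delta_carrier(3)])

lemma delta1_mult_delta2: "delta1 * delta2 = (0\<^sub>m 1 8 :: (var5, 'k::comm_ring_1) mpol mat)"
proof (rule eq_matI)
  fix i j assume "i < dim_row (0\<^sub>m 1 8 :: (var5, 'k) mpol mat)" "j < dim_col (0\<^sub>m 1 8 :: (var5, 'k) mpol mat)"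
  then have ij: "i < 1" "j < 8" by simp_all
  have "\<forall>j<8. (\<Sum>k<6. delta1 $$ (0, k) * delta2 $$ (k, j)) = (0 :: (var5, 'k) mpol)"
    unfolding all_less_3_6_8 sum_less_3_6_8
    by (simp add: delta1_def delta2_def mat_of_rows_list_nth)
       (simp add: algebra_simps power2_eq_square)
  then show "(delta1 * delta2) $$ (i, j) = (0\<^sub>m 1 8 :: (var5, 'k) mpol mat) $$ (i, j)"
    unfolding mult_mat_nth[OF delta_carrier(1,2) ij] using ij by simp
qed (simp_all add: carrier_matD[OF delta_carrier(1)] carrier_matD[OF delta_carrier(2)])

text \<open>
  The weight used for leading forms. The linear entries of \<open>\<delta>\<^sub>2\<close> and \<open>\<delta>\<^sub>3\<close> are taken at weight 1, the
  quadrics in \<open>\<delta>\<^sub>1\<close> at weight 2.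
\<close>

fun mid_wt :: "var5 \<Rightarrow> nat" where
  "mid_wt V1 = 0" | "mid_wt V2 = 1" | "mid_wt V3 = 1" | "mid_wt V4 = 1" | "mid_wt V5 = 0"

lemma Var_mult_in_homog_comp:
  "(Var i * Var j :: ('v::finite, 'k::comm_ring_1) mpol) \<in> homog_comp w (w i + w j)"
  by (intro mult_in_homog_comp Var_in_homog_comp)

lemma hcomp_quadric:
  "hcomp mid_wt 2 (Var i * Var j :: (var5, 'k::comm_ring_1) mpol) =
    (if mid_wt i + mid_wt j = 2 then Var i * Var j else 0)"
  by (auto simp: hcomp_homog[OF Var_mult_in_homog_comp])

lemma hcomp_Var:
  "hcomp mid_wt (Suc 0) (Var i :: (var5, 'k::comm_ring_1) mpol) = (if mid_wt i = 1 then Var i else 0)"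
  by (auto simp: hcomp_homog[OF Var_in_homog_comp])

lemma deg_le_Var: "deg_le mid_wt (Suc 0) (Var i :: (var5, 'k::comm_ring_1) mpol)"
  by (rule deg_le_homog[OF Var_in_homog_comp]) (cases i; simp)

lemma deg_le_quadric: "deg_le mid_wt 2 (Var i * Var j :: (var5, 'k::comm_ring_1) mpol)"
  using deg_le_mult[OF deg_le_Var deg_le_Var] by (simp add: numeral_2_eq_2)

lemma leading_mult_nth:
  fixes A :: "('v::finite, 'k::comm_ring_1) mpol mat"
  assumes "A \<in> carrier_mat n m" "v \<in> carrier_vec m" "i < n"
  shows "(leading_mat w a A *\<^sub>v v) $ i = (\<Sum>j<m. hcomp w a (A $$ (i, j)) * v $ j)"
  using assms by (subst mult_mat_vec_nth[where n = n and m = m]) auto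

lemma delta1_entries_deg_le:
  assumes "i < 1" "j < 6"
  shows "deg_le mid_wt 2 (delta1 $$ (i, j) :: (var5, 'k::comm_ring_1) mpol)"
proof -
  have "\<forall>j<6. deg_le mid_wt 2 (delta1 $$ (0, j) :: (var5, 'k) mpol)"
    unfolding all_less_3_6_8
    by (simp add: delta1_def mat_of_rows_list_nth power2_eq_square deg_le_diff deg_le_quadric)
  then show ?thesis using assms by simp
qed

lemma delta2_entries_deg_le:
  assumes "i < 6" "j < 8"
  shows "deg_le mid_wt (Suc 0) (delta2 $$ (i, j) :: (var5, 'k::comm_ring_1) mpol)"
proof -
  have "\<forall>i<6. \<forall>j<8. deg_le mid_wt (Suc 0) (delta2 $$ (i, j) :: (var5, 'k) mpol)"
    unfolding all_less_3_6_8
    by (simp add: delta2_def mat_of_rows_list_nth deg_le_uminus deg_le_Var)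
  then show ?thesis using assms by simp
qed

lemma delta3_entries_deg_le:
  assumes "i < 8" "j < 3"
  shows "deg_le mid_wt (Suc 0) (delta3 $$ (i, j) :: (var5, 'k::comm_ring_1) mpol)"
proof -
  have "\<forall>i<8. \<forall>j<3. deg_le mid_wt (Suc 0) (delta3 $$ (i, j) :: (var5, 'k) mpol)"
    unfolding all_less_3_6_8
    by (simp add: delta3_def mat_of_rows_list_nth deg_le_uminus deg_le_Var)
  then show ?thesis using assms by simp
qed

lemma leading_delta1_mult:
  assumes "v \<in> carrier_vec 6"
  shows "(leading_mat mid_wt 2 delta1 *\<^sub>v v) $ 0 =
    (x2^2 * v $ 0 + x2 * x3 * v $ 1 + x3^2 * v $ 2 + x2 * x4 * v $ 3 + x3 * x4 * v $ 4 + x4^2 * v $ 5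
      :: (var5, 'k::comm_ring_1) mpol)"
  unfolding leading_mult_nth[OF delta_carrier(1) assms less_one[THEN iffD2, OF refl]] sum_less_3_6_8
  by (simp add: delta1_def mat_of_rows_list_nth)
     (simp add: power2_eq_square hcomp_diff hcomp_quadric)

lemma leading_delta2_mult:
  fixes v :: "(var5, 'k::comm_ring_1) mpol vec"
  assumes "v \<in> carrier_vec 8"
  defines "y \<equiv> leading_mat mid_wt (Suc 0) delta2 *\<^sub>v v"
  shows "y $ 0 = - x3 * v $ 0 - x4 * v $ 2" "y $ 1 = x2 * v $ 0 - x3 * v $ 1 - x4 * v $ 3"
    "y $ 2 = x2 * v $ 1 - x4 * v $ 5" "y $ 3 = x2 * v $ 2 + x3 * v $ 3 - x3 * v $ 4 - x4 * v $ 6"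
    "y $ 4 = x2 * v $ 4 + x3 * v $ 5 - x4 * v $ 7" "y $ 5 = x2 * v $ 6 + x3 * v $ 7"
proof -
  have "\<forall>i<6. y $ i = (\<Sum>j<8. hcomp mid_wt (Suc 0) (delta2 $$ (i, j)) * v $ j)"
    unfolding y_def using leading_mult_nth[OF delta_carrier(2) assms(1)] by blast
  then show "y $ 0 = - x3 * v $ 0 - x4 * v $ 2" "y $ 1 = x2 * v $ 0 - x3 * v $ 1 - x4 * v $ 3"
    "y $ 2 = x2 * v $ 1 - x4 * v $ 5" "y $ 3 = x2 * v $ 2 + x3 * v $ 3 - x3 * v $ 4 - x4 * v $ 6"
    "y $ 4 = x2 * v $ 4 + x3 * v $ 5 - x4 * v $ 7" "y $ 5 = x2 * v $ 6 + x3 * v $ 7"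
    unfolding all_less_3_6_8 sum_less_3_6_8
    by (simp_all add: delta2_def mat_of_rows_list_nth hcomp_uminus hcomp_Var)
qed

lemma leading_delta3_mult:
  fixes v :: "(var5, 'k::comm_ring_1) mpol vec"
  assumes "v \<in> carrier_vec 3"
  defines "y \<equiv> leading_mat mid_wt (Suc 0) delta3 *\<^sub>v v"
  shows "y $ 0 = x4 * v $ 0" "y $ 1 = x4 * v $ 1" "y $ 2 = - x3 * v $ 0"
    "y $ 3 = x2 * v $ 0 - x3 * v $ 1" "y $ 4 = - x3 * v $ 1 + x4 * v $ 2"
    "y $ 5 = x2 * v $ 1" "y $ 6 = - x3 * v $ 2" "y $ 7 = x2 * v $ 2"
proof -
  have "\<forall>i<8. y $ i = (\<Sum>j<3. hcomp mid_wt (Suc 0) (delta3 $$ (i, j)) * v $ j)"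
    unfolding y_def using leading_mult_nth[OF delta_carrier(3) assms(1)] by blast
  then show "y $ 0 = x4 * v $ 0" "y $ 1 = x4 * v $ 1" "y $ 2 = - x3 * v $ 0"
    "y $ 3 = x2 * v $ 0 - x3 * v $ 1" "y $ 4 = - x3 * v $ 1 + x4 * v $ 2"
    "y $ 5 = x2 * v $ 1" "y $ 6 = - x3 * v $ 2" "y $ 7 = x2 * v $ 2"
    unfolding all_less_3_6_8 sum_less_3_6_8
    by (simp_all add: delta3_def mat_of_rows_list_nth hcomp_uminus hcomp_Var)
qed

lemma eq_vec_by_entries:
  assumes "v \<in> carrier_vec n" "v' \<in> carrier_vec n" "\<forall>i<n. v $ i = v' $ i"
  shows "v = v'"
  using assms by (intro eq_vecI) auto

lemma mat_kernel_delta1: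
  "mat_kernel (delta1 :: (var5, 'k::comm_ring_1) mpol mat) = mat_image delta2"
proof (rule mat_kernel_eq_mat_image_by_leading_forms[OF delta_carrier(1,2) delta1_mult_delta2
      delta1_entries_deg_le delta2_entries_deg_le])
  fix v :: "(var5, 'k) mpol vec"
  assume v: "v \<in> carrier_vec 6" and ker: "leading_mat mid_wt 2 delta1 *\<^sub>v v = 0\<^sub>v 1"
  have "x2^2 * v $ 0 + x2 * x3 * v $ 1 + x3^2 * v $ 2 + x2 * x4 * v $ 3 + x3 * x4 * v $ 4 + x4^2 * v $ 5 = 0"
    using leading_delta1_mult[OF v] by (simp add: ker)
  then obtain u1 u2 u3 u4 u5 u6 u7 u8 where eqs:
    "v $ 0 = - x3 * u1 - x4 * u3" "v $ 1 = x2 * u1 - x3 * u2 - x4 * u4" "v $ 2 = x2 * u2 - x4 * u6"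
    "v $ 3 = x2 * u3 + x3 * u4 - x3 * u5 - x4 * u7" "v $ 4 = x2 * u5 + x3 * u6 - x4 * u8"
    "v $ 5 = x2 * u7 + x3 * u8"
    by (rule syzygies_of_quadrics)
  define u where "u = vec 8 ((!) [u1, u2, u3, u4, u5, u6, u7, u8])"
  have u: "u \<in> carrier_vec 8" by (simp only: u_def vec_carrier)
  have "v = leading_mat mid_wt (Suc 0) delta2 *\<^sub>v u"
  proof (rule eq_vec_by_entries[OF v])
    show "leading_mat mid_wt (Suc 0) delta2 *\<^sub>v u \<in> carrier_vec 6"
      by (rule mult_mat_vec_carrier[OF _ u]) (simp only: map_carrier_mat delta_carrier)
    show "\<forall>i<6. v $ i = (leading_mat mid_wt (Suc 0) delta2 *\<^sub>v u) $ i"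
      unfolding all_less_3_6_8 leading_delta2_mult[OF u] eqs
      by (simp add: u_def)
  qed
  with u show "\<exists>u\<in>carrier_vec 8. v = leading_mat mid_wt (Suc 0) delta2 *\<^sub>v u" by blast
qed

lemma mat_kernel_delta2:
  "mat_kernel (delta2 :: (var5, 'k::comm_ring_1) mpol mat) = mat_image delta3"
proof (rule mat_kernel_eq_mat_image_by_leading_forms[OF delta_carrier(2,3) delta2_mult_delta3
      delta2_entries_deg_le delta3_entries_deg_le])
  fix v :: "(var5, 'k) mpol vec"
  assume v: "v \<in> carrier_vec 8" and ker: "leading_mat mid_wt (Suc 0) delta2 *\<^sub>v v = 0\<^sub>v 6"
  have "- x3 * v $ 0 - x4 * v $ 2 = 0" "x2 * v $ 0 - x3 * v $ 1 - x4 * v $ 3 = 0"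
    "x2 * v $ 1 - x4 * v $ 5 = 0" "x2 * v $ 2 + x3 * v $ 3 - x3 * v $ 4 - x4 * v $ 6 = 0"
    "x2 * v $ 6 + x3 * v $ 7 = 0"
    unfolding leading_delta2_mult[OF v, symmetric] ker by simp_all
  then obtain c f e where eqs: "v $ 0 = x4 * c" "v $ 1 = x4 * f" "v $ 2 = - x3 * c"
    "v $ 3 = x2 * c - x3 * f" "v $ 4 = - x3 * f + x4 * e" "v $ 5 = x2 * f" "v $ 6 = - x3 * e"
    "v $ 7 = x2 * e"
    by (rule second_syzygies_of_quadrics)
  define u where "u = vec 3 ((!) [c, f, e])"
  have u: "u \<in> carrier_vec 3" by (simp only: u_def vec_carrier)
  have "v = leading_mat mid_wt (Suc 0) delta3 *\<^sub>v u"
  proof (rule eq_vec_by_entries[OF v])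
    show "leading_mat mid_wt (Suc 0) delta3 *\<^sub>v u \<in> carrier_vec 8"
      by (rule mult_mat_vec_carrier[OF _ u]) (simp only: map_carrier_mat delta_carrier)
    show "\<forall>i<8. v $ i = (leading_mat mid_wt (Suc 0) delta3 *\<^sub>v u) $ i"
      unfolding all_less_3_6_8 leading_delta3_mult[OF u] eqs
      by (simp add: u_def)
  qed
  with u show "\<exists>u\<in>carrier_vec 3. v = leading_mat mid_wt (Suc 0) delta3 *\<^sub>v u" by blast
qed

lemma mult_mat_0_cols: "A \<in> carrier_mat n 0 \<Longrightarrow> v \<in> carrier_vec 0 \<Longrightarrow> A *\<^sub>v v = 0\<^sub>v n"
  by (rule eq_vecI) (auto simp: scalar_prod_def)

text \<open>
  Injectivity is exactness with a zero module on the left, whose map to \<open>R\<^sup>3\<close> is the matrix with no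
  columns.
\<close>

lemma mat_kernel_delta3:
  "mat_kernel (delta3 :: (var5, 'k::comm_ring_1) mpol mat) = {0\<^sub>v 3}"
proof -
  let ?Z = "0\<^sub>m 3 0 :: (var5, 'k) mpol mat"
  have Z: "?Z \<in> carrier_mat 3 0" by (rule zero_carrier_mat)
  have "mat_kernel delta3 = mat_image ?Z"
  proof (rule mat_kernel_eq_mat_image_by_leading_forms[OF delta_carrier(3) Z, where w = mid_wt and a = "Suc 0" and b = 0])
    show "delta3 * ?Z = 0\<^sub>m 8 0" by (rule right_mult_zero_mat[OF delta_carrier(3)])
    fix i j :: nat assume "i < 8" "j < 3"
    then show "deg_le mid_wt (Suc 0) (delta3 $$ (i, j) :: (var5, 'k) mpol)"
      by (rule delta3_entries_deg_le)
  next
    fix i j :: nat assume "j < 0"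
    then show "deg_le mid_wt 0 (?Z $$ (i, j))" by (rule less_zeroE)
  next
    fix v :: "(var5, 'k) mpol vec"
    assume v: "v \<in> carrier_vec 3" and ker: "leading_mat mid_wt (Suc 0) delta3 *\<^sub>v v = 0\<^sub>v 8"
    have *: "x4 * v $ 0 = 0" "x4 * v $ 1 = 0" "x2 * v $ 2 = 0"
      unfolding leading_delta3_mult(1,2,8)[OF v, symmetric] ker by simp_all
    then have "\<forall>i<3. v $ i = 0"
      unfolding all_less_3_6_8 by (intro conjI *[THEN Var_mult_eq_0])
    then have "v = 0\<^sub>v 3" by (intro eq_vec_by_entries[OF v]) simp_all
    also have "\<dots> = leading_mat mid_wt 0 ?Z *\<^sub>v 0\<^sub>v 0"
      by (rule mult_mat_0_cols[symmetric]) (simp_all only: map_carrier_mat Z zero_carrier_vec)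
    finally show "\<exists>u\<in>carrier_vec 0. v = leading_mat mid_wt 0 ?Z *\<^sub>v u"
      by (intro bexI[of _ "0\<^sub>v 0"] zero_carrier_vec)
  qed
  also have "\<dots> = (\<lambda>u :: (var5, 'k) mpol vec. 0\<^sub>v 3) ` carrier_vec 0"
    unfolding mat_image_def carrier_matD(2)[OF Z] by (intro image_cong refl mult_mat_0_cols[OF Z])
  also have "\<dots> = {0\<^sub>v 3}"
  proof (rule image_constant)
    show "0\<^sub>v 0 \<in> carrier_vec 0" by (rule zero_carrier_vec)
  qed
  finally show ?thesis .
qed

section \<open>The monoid algebra homomorphism given by the degree\<close>

text \<open>
  The algebra homomorphism \<open>x\<^sub>i \<mapsto> t\<^bsup>w i\<^esup>\<close> written as a sum over monomials. In this form it is
  clear that it acts on each homogeneous component separately.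
\<close>

definition monom_map ::
  "('v::finite \<Rightarrow> 'g::comm_monoid_add) \<Rightarrow> ('v, 'k::comm_ring_1) mpol \<Rightarrow> ('g \<Rightarrow>\<^sub>0 'k)" where
  "monom_map w f = (\<Sum>m\<in>keys f. Poly_Mapping.single (monom_deg w m) (lookup f m))"

lemma monom_map_superset:
  "finite A \<Longrightarrow> keys f \<subseteq> A \<Longrightarrow>
    monom_map w f = (\<Sum>m\<in>A. Poly_Mapping.single (monom_deg w m) (lookup f m))"
  unfolding monom_map_def by (rule sum.mono_neutral_left) (auto simp: in_keys_iff)

lemma monom_map_add: "monom_map w (f + f') = monom_map w f + monom_map w f'"
  using keys_add[of f f']
  by (simp add: monom_map_superset[where A = "keys f \<union> keys f'"] lookup_add single_add sum.distrib)

lemma monom_map_0 [simp]: "monom_map w 0 = 0"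
  by (simp add: monom_map_def)

lemma monom_map_sum: "monom_map w (\<Sum>i\<in>I. f i) = (\<Sum>i\<in>I. monom_map w (f i))"
  by (induction I rule: infinite_finite_induct) (simp_all add: monom_map_add)

lemma monom_map_single:
  "monom_map w (Poly_Mapping.single m c) = Poly_Mapping.single (monom_deg w m) c"
  by (simp add: monom_map_def)

lemma monom_map_uminus: "monom_map w (- f) = - monom_map w f"
  using monom_map_add[of w f "- f"] by (simp add: eq_neg_iff_add_eq_0 add.commute)

lemma monom_map_diff: "monom_map w (f - f') = monom_map w f - monom_map w f'"
  using monom_map_add[of w f "- f'"] by (simp add: monom_map_uminus)

lemma sum_single_keys: "(\<Sum>m\<in>keys f. Poly_Mapping.single m (lookup f m)) = f"
proof (rule poly_mapping_eqI)
  fix m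
  have "lookup (\<Sum>m\<in>keys f. Poly_Mapping.single m (lookup f m)) m =
      (\<Sum>m'\<in>keys f. if m' = m then lookup f m else 0)"
    unfolding lookup_sum by (intro sum.cong refl) (auto simp: lookup_single when_def)
  also have "\<dots> = lookup f m" by (cases "m \<in> keys f") (auto simp: in_keys_iff)
  finally show "lookup (\<Sum>m\<in>keys f. Poly_Mapping.single m (lookup f m)) m = lookup f m" .
qed

lemma monom_map_mult: "monom_map w (f * f') = monom_map w f * monom_map w f'"
proof -
  have "f * f' = (\<Sum>m\<in>keys f. \<Sum>m'\<in>keys f'.
      Poly_Mapping.single (m + m') (lookup f m * lookup f' m'))"
    by (subst (1 2) sum_single_keys[symmetric]) (simp add: sum_product mult_single)
  then have "monom_map w (f * f') = (\<Sum>m\<in>keys f. \<Sum>m'\<in>keys f'.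
      Poly_Mapping.single (monom_deg w m + monom_deg w m') (lookup f m * lookup f' m'))"
    by (simp add: monom_map_sum monom_map_single monom_deg_add)
  then show ?thesis
    by (simp add: monom_map_def sum_product mult_single)
qed

lemma monom_map_1 [simp]: "monom_map w 1 = 1"
  using monom_map_single[of w 0 1] by simp

lemma monom_map_Var: "monom_map w (Var i) = Poly_Mapping.single (w i) 1"
  unfolding Var_def monom_map_single monom_deg_single ..

lemma lookup_monom_map:
  "lookup (monom_map w f) g = (\<Sum>m\<in>keys f. lookup f m when monom_deg w m = g)"
  by (simp add: monom_map_def lookup_sum lookup_single)

lemma keys_monom_map: "keys (monom_map w f) \<subseteq> range (monom_deg w)"
proof
  fix g assume "g \<in> keys (monom_map w f)"
  then have "(\<Sum>m\<in>keys f. lookup f m when monom_deg w m = g) \<noteq> 0"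
    by (simp add: in_keys_iff lookup_monom_map)
  then obtain m where "(lookup f m when monom_deg w m = g) \<noteq> 0"
    by (rule sum.not_neutral_contains_not_neutral)
  then show "g \<in> range (monom_deg w)" by auto
qed

lemma monom_map_homog:
  "f \<in> homog_comp w g \<Longrightarrow> monom_map w f = Poly_Mapping.single g (lookup (monom_map w f) g)"
  by (rule poly_mapping_eqI)
     (auto simp: lookup_monom_map lookup_single homog_comp_def when_def intro!: sum.neutral)

text \<open>
  Because the target of degree \<open>g\<close> is spanned by the single monomial \<open>t\<^sup>g\<close>, the image of the
  component of degree \<open>g\<close> is the term of degree \<open>g\<close> of the image. So the kernel is homogeneous.
\<close>

lemma monom_map_hcomp:
  "monom_map w (hcomp w g f) = Poly_Mapping.single g (lookup (monom_map w f) g)"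
proof -
  have "lookup (monom_map w (hcomp w g f)) g = lookup (monom_map w f) g"
    unfolding lookup_monom_map
    by (rule sum.mono_neutral_cong_left) (auto simp: keys_hcomp lookup_hcomp when_def)
  then show ?thesis using monom_map_homog[OF hcomp_in_homog_comp, of w g f] by simp
qed

lemma monom_map_surj:
  assumes "keys p \<subseteq> range (monom_deg w)"
  obtains f where "monom_map w f = p"
proof
  define r where "r g = (SOME m. monom_deg w m = g)" for g
  have r: "monom_deg w (r g) = g" if "g \<in> keys p" for g
    using assms that unfolding r_def by (metis (mono_tags) imageE someI subsetD)
  have "monom_map w (\<Sum>g\<in>keys p. Poly_Mapping.single (r g) (lookup p g)) =
      (\<Sum>g\<in>keys p. Poly_Mapping.single g (lookup p g))"
    using r by (simp add: monom_map_sum monom_map_single)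
  then show "monom_map w (\<Sum>g\<in>keys p. Poly_Mapping.single (r g) (lookup p g)) = p"
    by (simp add: sum_single_keys)
qed

text \<open>
  No two monomials of \<open>f\<close> have the same image, so nothing can cancel.
\<close>

lemma eq_0_if_monom_map_eq_0:
  assumes "inj_on (monom_deg w) (keys f)" "monom_map w f = 0"
  shows "f = 0"
proof (rule poly_mapping_eqI)
  fix m
  show "lookup f m = lookup 0 m"
  proof (cases "m \<in> keys f")
    case True
    have "0 = lookup (monom_map w f) (monom_deg w m)" by (simp add: assms(2))
    also have "\<dots> = (\<Sum>m'\<in>keys f. if m' = m then lookup f m else 0)"
      unfolding lookup_monom_map using True assms(1)
      by (intro sum.cong refl) (auto simp: when_def inj_on_def)
    finally show ?thesis using True by simp
  qed (simp add: in_keys_iff)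
qed

lemma single_power: "Poly_Mapping.single g (1 :: 'k::comm_ring_1) ^ n = Poly_Mapping.single (nscale n g) 1"
  by (induction n) (simp_all add: nscale_def mult_single add.commute)

lemma prod_single: "(\<Prod>i\<in>I. Poly_Mapping.single (h i) (1 :: 'k::comm_ring_1)) = Poly_Mapping.single (\<Sum>i\<in>I. h i) 1"
  by (induction I rule: infinite_finite_induct) (simp_all add: mult_single)

lemma phi_eq_monom_map: "phi a d = monom_map (wt a d)"
  by (rule ext)
     (simp add: phi_def mpol_eval_def monom_map_def monom_deg_def single_power prod_single mult_single)

section \<open>The defining ideal\<close>

lemma UNIV_var5: "(UNIV :: var5 set) = {V1, V2, V3, V4, V5}"
  by (auto intro: var5.exhaust)

lemma nscale_nat: "nscale n (k::nat) = n * k"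
  by (simp add: nscale_def)

lemma fst_nscale: "fst (nscale n p) = n * fst (p :: nat \<times> nat)"
  by (induction n) (simp_all add: nscale_def)

lemma snd_nscale: "snd (nscale n p) = n * snd (p :: nat \<times> nat)"
  by (induction n) (simp_all add: nscale_def)

lemma monom_deg_mid_wt: "monom_deg mid_wt m = lookup m V2 + lookup m V3 + lookup m V4"
  by (simp add: monom_deg_def UNIV_var5 nscale_nat)

lemma monom_deg_wt:
  "monom_deg (wt a d) m =
    nscale (lookup m V1 + lookup m V2 + lookup m V3 + lookup m V4 + lookup m V5) a +
    nscale (lookup m V2 + 2 * lookup m V3 + 3 * lookup m V4 + 4 * lookup m V5) d"
  by (rule prod_eqI) (simp_all add: monom_deg_def UNIV_var5 fst_nscale snd_nscale algebra_simps)

lemma lin_indep_rat_cancel: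
  assumes "lin_indep_rat a d" "nscale p a + nscale q d = nscale p' a + nscale q' d"
  shows "p = p' \<and> q = q'"
proof -
  let ?P = "of_nat p - of_nat p' :: rat" and ?Q = "of_nat q - of_nat q' :: rat"
  have "p * fst a + q * fst d = p' * fst a + q' * fst d"
    "p * snd a + q * snd d = p' * snd a + q' * snd d"
    using arg_cong[OF assms(2), of fst] arg_cong[OF assms(2), of snd]
    by (simp_all add: fst_nscale snd_nscale)
  note eqs = this
  have "?P * of_nat (fst a) + ?Q * of_nat (fst d) =
      of_nat (p * fst a + q * fst d) - of_nat (p' * fst a + q' * fst d)"
    "?P * of_nat (snd a) + ?Q * of_nat (snd d) =
      of_nat (p * snd a + q * snd d) - of_nat (p' * snd a + q' * snd d)"
    by (simp_all add: left_diff_distrib)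
  then have "?P * of_nat (fst a) + ?Q * of_nat (fst d) = 0 \<and> ?P * of_nat (snd a) + ?Q * of_nat (snd d) = 0"
    unfolding eqs by simp
  then have "?P = 0 \<and> ?Q = 0" using assms(1) unfolding lin_indep_rat_def by blast
  then show ?thesis by simp
qed

text \<open>
  The hypotheses say that two monomials with at most one factor among \<open>x\<^sub>2\<close>, \<open>x\<^sub>3\<close>, \<open>x\<^sub>4\<close> have equally
  many factors and equal weighted exponent sums. Modulo 4 the latter sum is \<open>0\<close>, \<open>1\<close>, \<open>2\<close> or \<open>3\<close>
  according to which of these factors, if any, is present.
\<close>

lemma small_exponents_determined:
  fixes m1 m2 m3 m4 m5 n1 n2 n3 n4 n5 :: nat
  assumes "m2 + m3 + m4 \<le> 1" "n2 + n3 + n4 \<le> 1"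
    and sums: "m1 + m2 + m3 + m4 + m5 = n1 + n2 + n3 + n4 + n5"
      "m2 + 2 * m3 + 3 * m4 + 4 * m5 = n2 + 2 * n3 + 3 * n4 + 4 * n5"
  shows "m1 = n1 \<and> m2 = n2 \<and> m3 = n3 \<and> m4 = n4 \<and> m5 = n5"
proof -
  have m: "m2 = 0 \<and> m3 = 0 \<and> m4 = 0 \<or> m2 = 1 \<and> m3 = 0 \<and> m4 = 0 \<or>
      m2 = 0 \<and> m3 = 1 \<and> m4 = 0 \<or> m2 = 0 \<and> m3 = 0 \<and> m4 = 1"
    using assms(1) by linarith
  have n: "n2 = 0 \<and> n3 = 0 \<and> n4 = 0 \<or> n2 = 1 \<and> n3 = 0 \<and> n4 = 0 \<or>
      n2 = 0 \<and> n3 = 1 \<and> n4 = 0 \<or> n2 = 0 \<and> n3 = 0 \<and> n4 = 1"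
    using assms(2) by linarith
  have "(m2 + 2 * m3 + 3 * m4 + 4 * m5) mod 4 = (n2 + 2 * n3 + 3 * n4 + 4 * n5) mod 4"
    using sums(2) by simp
  then have "(m2 + 2 * m3 + 3 * m4) mod 4 = (n2 + 2 * n3 + 3 * n4) mod 4"
    by simp
  with m n have "m2 = n2 \<and> m3 = n3 \<and> m4 = n4" by (elim disjE conjE) simp_all
  with sums show ?thesis by simp
qed

lemma inj_on_monom_deg_wt:
  assumes "lin_indep_rat a d"
  shows "inj_on (monom_deg (wt a d)) {m. monom_deg mid_wt m \<le> 1}"
proof (rule inj_onI)
  fix m m'
  assume m: "m \<in> {m. monom_deg mid_wt m \<le> 1}" "m' \<in> {m. monom_deg mid_wt m \<le> 1}"
    and eq: "monom_deg (wt a d) m = monom_deg (wt a d) m'"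
  from m have le: "lookup m V2 + lookup m V3 + lookup m V4 \<le> 1"
    "lookup m' V2 + lookup m' V3 + lookup m' V4 \<le> 1"
    by (simp_all add: monom_deg_mid_wt)
  from lin_indep_rat_cancel[OF assms eq[unfolded monom_deg_wt]]
  have sums: "lookup m V1 + lookup m V2 + lookup m V3 + lookup m V4 + lookup m V5 =
      lookup m' V1 + lookup m' V2 + lookup m' V3 + lookup m' V4 + lookup m' V5"
    "lookup m V2 + 2 * lookup m V3 + 3 * lookup m V4 + 4 * lookup m V5 =
      lookup m' V2 + 2 * lookup m' V3 + 3 * lookup m' V4 + 4 * lookup m' V5"
    by blast+
  have eqs: "lookup m V1 = lookup m' V1 \<and> lookup m V2 = lookup m' V2 \<and> lookup m V3 = lookup m' V3 \<and>
      lookup m V4 = lookup m' V4 \<and> lookup m V5 = lookup m' V5"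
    by (rule small_exponents_determined[OF le sums])
  show "m = m'"
  proof (intro poly_mapping_eqI)
    fix i show "lookup m i = lookup m' i" by (cases i) (use eqs in simp_all)
  qed
qed

text \<open>
  Every monomial of positive weight is divisible by \<open>x\<^sub>2\<close>, \<open>x\<^sub>3\<close> or \<open>x\<^sub>4\<close>. Passing to components makes
  the cofactors homogeneous, so that the lemma can be applied to them again.
\<close>

lemma homog_mid_splitE:
  fixes f :: "(var5, 'k::comm_ring_1) mpol"
  assumes "f \<in> homog_comp mid_wt (Suc n)"
  obtains p q r where "f = x2 * p + x3 * q + x4 * r"
    "p \<in> homog_comp mid_wt n" "q \<in> homog_comp mid_wt n" "r \<in> homog_comp mid_wt n"
proof -
  have "f \<in> var_ideal {V2, V3, V4}"
    using assms by (fastforce simp: homog_comp_def var_ideal_def monom_deg_mid_wt)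
  then obtain p q r where f: "f = x2 * p + (x3 * q + x4 * r)"
    by (metis var_ideal_insertE var_ideal_singletonE)
  have *: "hcomp mid_wt (Suc n) (Var i * g) = Var i * hcomp mid_wt n g"
    if "mid_wt i = 1" for i and g :: "(var5, 'k) mpol"
    using hcomp_mult_homog[OF Var_in_homog_comp[of i mid_wt], of n g] that by simp
  have "f = hcomp mid_wt (Suc n) f" using assms by (simp add: hcomp_homog)
  also have "\<dots> = x2 * hcomp mid_wt n p + x3 * hcomp mid_wt n q + x4 * hcomp mid_wt n r"
    by (simp add: f hcomp_add * add.assoc)
  finally show ?thesis by (rule that) simp_all
qed

lemma delta1_mult_0: "(delta1 *\<^sub>v 0\<^sub>v 6) $ 0 = 0"
  by (subst mult_mat_vec_nth[OF delta_carrier(1)]) simp_all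

text \<open>
  Division by the quadrics: their leading forms are all the products of two of \<open>x\<^sub>2\<close>, \<open>x\<^sub>3\<close>, \<open>x\<^sub>4\<close>, so
  a top component of weight at least 2 can be cancelled.
\<close>

lemma reduce_mod_delta1:
  fixes f :: "(var5, 'k::comm_ring_1) mpol"
  assumes "deg_le mid_wt N f"
  shows "\<exists>u\<in>carrier_vec 6. deg_le mid_wt 1 (f - (delta1 *\<^sub>v u) $ 0)"
  using assms
proof (induction N arbitrary: f)
  case (0 f)
  then have "deg_le mid_wt 1 f" by (simp add: deg_le_def)
  then have "deg_le mid_wt 1 (f - (delta1 *\<^sub>v 0\<^sub>v 6) $ 0)"
    by (simp add: delta1_mult_0)
  then show ?case by (rule bexI) simp
next
  case (Suc N f)
  show ?case
  proof (cases N)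
    case 0
    then have "deg_le mid_wt 1 (f - (delta1 *\<^sub>v 0\<^sub>v 6) $ 0)"
      using Suc.prems by (simp add: delta1_mult_0)
    then show ?thesis by (rule bexI) simp
  next
    case (Suc n)
    define v where "v = vec 1 (\<lambda>_. f)"
    have v: "v \<in> carrier_vec 1" by (simp add: v_def)
    obtain p q r where top: "hcomp mid_wt (Suc N) f = x2 * p + x3 * q + x4 * r"
      and pqr: "p \<in> homog_comp mid_wt N" "q \<in> homog_comp mid_wt N" "r \<in> homog_comp mid_wt N"
      using homog_mid_splitE[OF hcomp_in_homog_comp] by blast
    obtain p1 p2 p3 where p: "p = x2 * p1 + x3 * p2 + x4 * p3"
      using homog_mid_splitE[OF pqr(1)[unfolded Suc]] by blast
    obtain q1 q2 q3 where q: "q = x2 * q1 + x3 * q2 + x4 * q3"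
      using homog_mid_splitE[OF pqr(2)[unfolded Suc]] by blast
    obtain r1 r2 r3 where r: "r = x2 * r1 + x3 * r2 + x4 * r3"
      using homog_mid_splitE[OF pqr(3)[unfolded Suc]] by blast
    \<comment> \<open>Collects the coefficients of the six products; mixed products arise in two ways.\<close>
    define u where "u = vec 6 ((!) [p1, p2 + q1, q2, p3 + r1, q3 + r2, r3])"
    have u: "u \<in> carrier_vec 6" by (simp only: u_def vec_carrier)
    have top_eq: "map_vec (hcomp mid_wt (Suc N)) v = leading_mat mid_wt 2 delta1 *\<^sub>v u"
    proof (rule eq_vec_by_entries[of _ 1])
      show "leading_mat mid_wt 2 delta1 *\<^sub>v u \<in> carrier_vec 1"
        by (rule mult_mat_vec_carrier[OF _ u]) (simp only: map_carrier_mat delta_carrier)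
      have "hcomp mid_wt (Suc N) f = (leading_mat mid_wt 2 delta1 *\<^sub>v u) $ 0"
        unfolding leading_delta1_mult[OF u] top p q r
        by (simp add: u_def) (simp add: algebra_simps power2_eq_square)
      then show "\<forall>i<1. map_vec (hcomp mid_wt (Suc N)) v $ i = (leading_mat mid_wt 2 delta1 *\<^sub>v u) $ i"
        by (simp add: v_def)
    qed (use v in simp)
    have deg_v: "deg_le mid_wt (Suc N) (v $ i)" if "i < 1" for i
      using that Suc.prems by (simp add: v_def)
    obtain u' where u': "u' \<in> carrier_vec 6"
      "deg_le mid_wt (Suc N) ((v - delta1 *\<^sub>v u') $ 0)"
      "hcomp mid_wt (Suc N) ((v - delta1 *\<^sub>v u') $ 0) = 0"
      by (rule cancel_top_component[OF delta_carrier(1) delta1_entries_deg_le v deg_v u top_eq])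
        (assumption | simp only: less_one)+
    have "(v - delta1 *\<^sub>v u') $ 0 = f - (delta1 *\<^sub>v u') $ 0"
      by (simp add: v_def carrier_matD[OF delta_carrier(1)])
    with u' have "deg_le mid_wt N (f - (delta1 *\<^sub>v u') $ 0)"
      by (auto intro: deg_le_if_hcomp_eq_0)
    from Suc.IH[OF this] obtain u'' where u'': "u'' \<in> carrier_vec 6"
      "deg_le mid_wt 1 (f - (delta1 *\<^sub>v u') $ 0 - (delta1 *\<^sub>v u'') $ 0)" by blast
    have "(delta1 *\<^sub>v (u' + u'')) $ 0 = (delta1 *\<^sub>v u') $ 0 + (delta1 *\<^sub>v u'') $ 0"
      using mult_add_distrib_mat_vec[OF delta_carrier(1) u'(1) u''(1)]
      by (simp add: carrier_matD[OF delta_carrier(1)])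
    then show ?thesis
      using u'' u'(1) by (intro bexI[of _ "u' + u''"]) (simp_all add: diff_diff_eq)
  qed
qed

lemma phi_delta1:
  assumes "u \<in> carrier_vec 6"
  shows "phi a d ((delta1 *\<^sub>v u) $ 0) = (0 :: (nat \<times> nat) \<Rightarrow>\<^sub>0 'k::comm_ring_1)"
proof -
  have "\<forall>j<6. phi a d (delta1 $$ (0, j)) = (0 :: (nat \<times> nat) \<Rightarrow>\<^sub>0 'k)"
    unfolding all_less_3_6_8
    by (simp add: delta1_def mat_of_rows_list_nth)
       (simp add: phi_eq_monom_map power2_eq_square monom_map_diff monom_map_mult monom_map_Var
        mult_single nscale_def eval_nat_numeral ac_simps)
  then show ?thesis
    unfolding mult_mat_vec_nth[OF delta_carrier(1) assms less_one[THEN iffD2, OF refl]]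
    by (simp add: phi_eq_monom_map monom_map_sum monom_map_mult)
qed

text \<open>
  A polynomial in the kernel is reduced modulo the image of \<open>\<delta>\<^sub>1\<close> to one of weight at most 1, which
  still lies in the kernel. On such monomials the degree is injective, so the remainder is \<open>0\<close>.
\<close>

lemma phi_eq_0_iff:
  fixes f :: "(var5, 'k::comm_ring_1) mpol"
  assumes "lin_indep_rat a d"
  shows "phi a d f = 0 \<longleftrightarrow> (\<exists>u\<in>carrier_vec 6. f = (delta1 *\<^sub>v u) $ 0)"
proof
  assume f: "phi a d f = 0"
  obtain N where "deg_le mid_wt N f" using deg_le_ex by blast
  then obtain u where u: "u \<in> carrier_vec 6" "deg_le mid_wt 1 (f - (delta1 *\<^sub>v u) $ 0)"
    using reduce_mod_delta1 by blast
  let ?r = "f - (delta1 *\<^sub>v u) $ 0"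
  have "inj_on (monom_deg (wt a d)) (keys ?r)"
    by (rule inj_on_subset[OF inj_on_monom_deg_wt[OF assms]]) (use u(2) in \<open>auto simp: deg_le_def\<close>)
  moreover have "monom_map (wt a d) ?r = 0"
    using f phi_delta1[OF u(1), of a d] by (simp add: phi_eq_monom_map monom_map_diff)
  ultimately have "?r = 0" by (rule eq_0_if_monom_map_eq_0)
  with u(1) show "\<exists>u\<in>carrier_vec 6. f = (delta1 *\<^sub>v u) $ 0" by auto
qed (auto simp: phi_delta1)

section \<open>Graded cyclic modules\<close>

lemma cring_class_ring: "cring (class_ring :: 'a::comm_ring_1 ring)"
  by (fact class_cring.is_cring)

lemma module_vec_module: "module (class_ring :: 'a::comm_ring_1 ring) (module_vec TYPE('a) n)"
proof (rule moduleI)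
  show "abelian_group (module_vec TYPE('a) n)"
  proof (rule abelian_groupI)
    fix x assume "x \<in> carrier (module_vec TYPE('a) n)"
    then show "\<exists>y\<in>carrier (module_vec TYPE('a) n). y \<oplus>\<^bsub>module_vec TYPE('a) n\<^esub> x = \<zero>\<^bsub>module_vec TYPE('a) n\<^esub>"
      by (auto simp: module_vec_simps intro!: bexI[of _ "- x"])
  qed (auto simp: module_vec_simps assoc_add_vec comm_add_vec)
qed (auto simp: module_vec_simps cring_class_ring add_smult_distrib_vec smult_add_distrib_vec)

lemma restrict_scalars_simps:
  "carrier (restrict_scalars h A) = carrier A" "zero (restrict_scalars h A) = zero A"
  "add (restrict_scalars h A) = add A" "r \<odot>\<^bsub>restrict_scalars h A\<^esub> x = h r \<otimes>\<^bsub>A\<^esub> x"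
  by (simp_all add: restrict_scalars_def)

lemma module_restrict_scalars:
  fixes h :: "'r::comm_ring_1 \<Rightarrow> 'm" and A :: "'m ring"
  assumes "cring A" and h: "h \<in> Ring.ring_hom class_ring A"
  shows "module class_ring (restrict_scalars h A)"
proof -
  interpret A: cring A by fact
  have "abelian_group (restrict_scalars h A)"
  proof (rule abelian_groupI)
    fix x assume "x \<in> carrier (restrict_scalars h A)"
    then show "\<exists>y\<in>carrier (restrict_scalars h A). y \<oplus>\<^bsub>restrict_scalars h A\<^esub> x = \<zero>\<^bsub>restrict_scalars h A\<^esub>"
      by (intro bexI[of _ "\<ominus>\<^bsub>A\<^esub> x"]) (auto simp: restrict_scalars_simps A.l_neg)
  qed (auto simp: restrict_scalars_simps A.a_ac)
  then show ?thesis
    using ring_hom_closed[OF h] ring_hom_add[OF h] ring_hom_mult[OF h] ring_hom_one[OF h]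
    by (intro moduleI)
       (auto simp: restrict_scalars_simps cring_class_ring A.l_distr A.r_distr A.m_assoc)
qed

text \<open>
  A cyclic module presented by the \<open>R\<close>-linear surjection \<open>\<psi>\<close> from \<open>R\<close>. The last assumption says that the
  kernel of \<open>\<psi>\<close> is homogeneous, which makes the images of the components of \<open>R\<close>
  independent.
\<close>

locale graded_cyclic_module =
  fixes w :: "'v::finite \<Rightarrow> 'g::comm_monoid_add"
    and M :: "(('v, 'k::comm_ring_1) mpol, 'm) module" (structure)
    and \<psi> :: "('v, 'k) mpol \<Rightarrow> 'm"
  assumes module_M: "module class_ring M"
    and \<psi>_add: "\<psi> (f + f') = \<psi> f \<oplus> \<psi> f'"
    and \<psi>_mult: "\<psi> (r * f) = r \<odot> \<psi> f"
    and \<psi>_surj: "range \<psi> = carrier M"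
    and \<psi>_hcomp: "\<psi> f = \<zero> \<Longrightarrow> \<psi> (hcomp w g f) = \<zero>"
begin

interpretation M: Module.module class_ring M by (fact module_M)

lemma \<psi>_closed [simp]: "\<psi> f \<in> carrier M"
  using \<psi>_surj by auto

lemma \<psi>_0 [simp]: "\<psi> 0 = \<zero>"
  using \<psi>_mult[of 0 0] M.smult_l_null[of "\<psi> 0"] by simp

lemma \<psi>_uminus: "\<psi> (- f) = \<ominus> \<psi> f"
  using \<psi>_add[of "- f" f] by (intro M.minus_equality[symmetric]) auto

lemma \<psi>_eq_iff: "\<psi> f = \<psi> f' \<longleftrightarrow> \<psi> (f - f') = \<zero>"
proof -
  have "\<psi> f = \<psi> (f - f') \<oplus> \<psi> f'" by (simp flip: \<psi>_add)
  moreover have "f - f' = f + - f'" by simp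
  then have "\<psi> (f - f') = \<psi> f \<oplus> \<ominus> \<psi> f'"
    by (simp only: \<psi>_add \<psi>_uminus)
  ultimately show ?thesis using M.r_neg[of "\<psi> f'"] by auto
qed

lemma \<psi>_sum: "finite I \<Longrightarrow> \<psi> (\<Sum>i\<in>I. f i) = (\<Oplus>i\<in>I. \<psi> (f i))"
  by (induction I rule: finite_induct) (auto simp: \<psi>_add M.finsum_insert)

lemma subgroup_component: "subgroup (\<psi> ` homog_comp w g) (add_monoid M)"
proof (rule group.subgroupI[OF M.a_group])
  show "\<psi> ` homog_comp w g \<subseteq> carrier (add_monoid M)" by auto
  show "\<psi> ` homog_comp w g \<noteq> {}" using zero_in_homog_comp by blast
  fix x assume "x \<in> \<psi> ` homog_comp w g"
  then obtain f where f: "x = \<psi> f" "f \<in> homog_comp w g" by blast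
  have "inv\<^bsub>add_monoid M\<^esub> x = \<psi> (- f)"
    by (simp add: f(1) \<psi>_uminus a_inv_def)
  then show "inv\<^bsub>add_monoid M\<^esub> x \<in> \<psi> ` homog_comp w g"
    using uminus_in_homog_comp[OF f(2)] by (simp only: imageI)
  fix y assume "y \<in> \<psi> ` homog_comp w g"
  then obtain f' where f': "y = \<psi> f'" "f' \<in> homog_comp w g" by blast
  have "x \<otimes>\<^bsub>add_monoid M\<^esub> y = \<psi> (f + f')"
    by (simp add: f(1) f'(1) \<psi>_add)
  then show "x \<otimes>\<^bsub>add_monoid M\<^esub> y \<in> \<psi> ` homog_comp w g"
    using add_in_homog_comp[OF f(2) f'(2)] by (simp only: imageI)
qed

text \<open>
  Lift the given components to homogeneous elements \<open>r g\<close> of \<open>R\<close>. Their sum differs from \<open>f\<close> by an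
  element of the kernel, and homogeneity of the kernel allows to compare the two in each degree.
\<close>

lemma decomposition_unique:
  assumes fin: "finite {g. c g \<noteq> \<zero>}" and c: "\<And>g. c g \<in> \<psi> ` homog_comp w g"
    and sum: "\<psi> f = (\<Oplus>g\<in>{g. c g \<noteq> \<zero>}. c g)"
  shows "c g = \<psi> (hcomp w g f)"
proof -
  let ?G = "{g. c g \<noteq> \<zero>}"
  obtain r where r: "\<And>g. r g \<in> homog_comp w g" "\<And>g. c g = \<psi> (r g)"
    using c unfolding image_iff by metis
  define f' where "f' = (\<Sum>g\<in>?G. r g)"
  have "\<psi> f = \<psi> f'"
    unfolding sum f'_def \<psi>_sum[OF fin] r(2)[symmetric] ..
  then have "\<psi> (hcomp w g f) = \<psi> (hcomp w g f')"
    using \<psi>_hcomp by (simp add: \<psi>_eq_iff flip: hcomp_diff)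
  also have "hcomp w g f' = (\<Sum>h\<in>?G. if h = g then r g else 0)"
    unfolding f'_def hcomp_sum by (intro sum.cong refl) (auto simp: hcomp_homog[OF r(1)])
  also have "\<psi> \<dots> = c g"
    using fin by (auto simp: r(2))
  finally show ?thesis by simp
qed

lemma decomposition_exists:
  shows "finite {g. \<psi> (hcomp w g f) \<noteq> \<zero>}"
    and "\<psi> f = (\<Oplus>g\<in>{g. \<psi> (hcomp w g f) \<noteq> \<zero>}. \<psi> (hcomp w g f))"
proof -
  define G where "G = monom_deg w ` keys f"
  have "hcomp w g f = 0" if "g \<notin> G" for g
    using that by (intro poly_mapping_eqI) (auto simp: lookup_hcomp when_def G_def in_keys_iff)
  then have sub: "{g. \<psi> (hcomp w g f) \<noteq> \<zero>} \<subseteq> G"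
    by (metis (mono_tags, lifting) \<psi>_0 mem_Collect_eq subsetI)
  have G: "finite G" by (simp add: G_def)
  show "finite {g. \<psi> (hcomp w g f) \<noteq> \<zero>}" using finite_subset[OF sub G] .
  have "\<psi> f = \<psi> (\<Sum>g\<in>G. hcomp w g f)"
    using sum_hcomp[OF G, of w f] by (simp add: G_def)
  also have "\<dots> = (\<Oplus>g\<in>G. \<psi> (hcomp w g f))" by (rule \<psi>_sum[OF G])
  also have "\<dots> = (\<Oplus>g\<in>{g. \<psi> (hcomp w g f) \<noteq> \<zero>}. \<psi> (hcomp w g f))"
    by (rule M.add.finprod_mono_neutral_cong_left[symmetric]) (use G sub in auto)
  finally show "\<psi> f = (\<Oplus>g\<in>{g. \<psi> (hcomp w g f) \<noteq> \<zero>}. \<psi> (hcomp w g f))" .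
qed

lemma graded_module: "graded_module w M (\<lambda>g. \<psi> ` homog_comp w g)"
  unfolding graded_module_def
proof (intro conjI allI ballI)
  show "module class_ring M" by (fact module_M)
  show "subgroup (\<psi> ` homog_comp w g) (add_monoid M)" for g by (rule subgroup_component)
  show "r \<odot> x \<in> \<psi> ` homog_comp w (g + h)"
    if "r \<in> homog_comp w g" "x \<in> \<psi> ` homog_comp w h" for r x g h
    using that by (auto simp flip: \<psi>_mult intro!: imageI mult_in_homog_comp)
  fix x assume "x \<in> carrier M"
  then obtain f where f: "x = \<psi> f" using \<psi>_surj by blast
  show "\<exists>!c. finite {g. c g \<noteq> \<zero>} \<and> (\<forall>g. c g \<in> \<psi> ` homog_comp w g) \<and>
      x = (\<Oplus>g\<in>{g. c g \<noteq> \<zero>}. c g)"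
  proof (rule ex1I[of _ "\<lambda>g. \<psi> (hcomp w g f)"])
    show "finite {g. \<psi> (hcomp w g f) \<noteq> \<zero>} \<and> (\<forall>g. \<psi> (hcomp w g f) \<in> \<psi> ` homog_comp w g) \<and>
        x = (\<Oplus>g\<in>{g. \<psi> (hcomp w g f) \<noteq> \<zero>}. \<psi> (hcomp w g f))"
      using decomposition_exists[of f] by (simp add: f)
  next
    fix c assume c: "finite {g. c g \<noteq> \<zero>} \<and> (\<forall>g. c g \<in> \<psi> ` homog_comp w g) \<and>
      x = (\<Oplus>g\<in>{g. c g \<noteq> \<zero>}. c g)"
    show "c = (\<lambda>g. \<psi> (hcomp w g f))"
    proof
      fix g show "c g = \<psi> (hcomp w g f)"
        by (rule decomposition_unique) (use c f in simp_all)
    qed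
  qed
qed

lemma mod_hom_first_entry:
  "mod_hom class_ring (module_vec TYPE(('v, 'k) mpol) 1) M (\<lambda>v. \<psi> (v $ 0))"
proof (intro mod_hom.intro mod_hom_axioms.intro module_vec_module module_M)
  show "(\<lambda>v. \<psi> (v $ 0)) \<in> LinearCombinations.module_hom class_ring (module_vec TYPE(('v, 'k) mpol) 1) M"
    by (auto simp: LinearCombinations.module_hom_def module_vec_simps \<psi>_add \<psi>_mult)
qed

lemma image_first_entry: "(\<lambda>v. \<psi> (v $ 0)) ` carrier_vec 1 = carrier M"
proof -
  have "\<psi> f \<in> (\<lambda>v. \<psi> (v $ 0)) ` carrier_vec 1" for f
    by (rule image_eqI[of _ _ "vec 1 (\<lambda>_. f)"]) simp_all
  then show ?thesis unfolding \<psi>_surj[symmetric] by auto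
qed

end

section \<open>Degrees and minimality\<close>

text \<open>
  The elements of degree \<open>g\<close> in the shifted ring \<open>R(-s)\<close>; equivalently, the entries allowed in a
  matrix of degree 0 at a row of degree \<open>s\<close> and a column of degree \<open>g\<close>.
\<close>

definition shifted_comp ::
  "('v::finite \<Rightarrow> 'g::comm_monoid_add) \<Rightarrow> 'g \<Rightarrow> 'g \<Rightarrow> ('v, 'k::zero) mpol set" where
  "shifted_comp w s g = {f. \<forall>m\<in>keys f. monom_deg w m + s = g}"

lemma shifted_comp_0: "0 \<in> shifted_comp w s g"
  by (simp add: shifted_comp_def)

lemma shifted_comp_add:
  "f \<in> shifted_comp w s g \<Longrightarrow> f' \<in> shifted_comp w s g \<Longrightarrow> f + f' \<in> shifted_comp w s g"
  using keys_add[of f f'] by (auto simp: shifted_comp_def)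

lemma shifted_comp_uminus: "f \<in> shifted_comp w s g \<Longrightarrow> - f \<in> shifted_comp w s g"
  for f :: "('v::finite, 'k::ab_group_add) mpol"
  by (auto simp: shifted_comp_def in_keys_iff)

lemma shifted_comp_diff:
  "f \<in> shifted_comp w s g \<Longrightarrow> f' \<in> shifted_comp w s g \<Longrightarrow> f - f' \<in> shifted_comp w s g"
  for f f' :: "('v::finite, 'k::ab_group_add) mpol"
  using shifted_comp_add[of f w s g "- f'"] shifted_comp_uminus[of f' w s g] by simp

lemma shifted_comp_sum:
  "(\<And>i. i \<in> I \<Longrightarrow> f i \<in> shifted_comp w s g) \<Longrightarrow> (\<Sum>i\<in>I. f i) \<in> shifted_comp w s g"
  by (induction I rule: infinite_finite_induct) (auto intro: shifted_comp_add shifted_comp_0)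

lemma shifted_comp_mult:
  fixes f f' :: "('v::finite, 'k::comm_ring_1) mpol"
  assumes "f \<in> shifted_comp w s t" "f' \<in> shifted_comp w t g"
  shows "f * f' \<in> shifted_comp w s g"
proof -
  have "monom_deg w m + s = g" if m: "m \<in> keys (f * f')" for m
  proof -
    obtain p q where pq: "m = p + q" "p \<in> keys f" "q \<in> keys f'" using m keys_mult by blast
    have "monom_deg w m + s = monom_deg w q + (monom_deg w p + s)"
      by (simp add: pq(1) monom_deg_add ac_simps)
    also have "\<dots> = g" using assms pq(2,3) by (simp add: shifted_comp_def)
    finally show ?thesis .
  qed
  then show ?thesis by (simp add: shifted_comp_def)
qed

lemma shifted_comp_Var: "w i + s = g \<Longrightarrow> Var i \<in> shifted_comp w s g"
  by (simp add: shifted_comp_def Var_def monom_deg_single del: One_nat_def)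

lemma free_comp_iff:
  "v \<in> free_comp w s g \<longleftrightarrow>
    v \<in> carrier_vec (length s) \<and> (\<forall>j<length s. v $ j \<in> shifted_comp w (s ! j) g)"
  by (simp add: free_comp_def shifted_comp_def)

lemma mult_mat_vec_in_free_comp:
  fixes A :: "('v::finite, 'k::comm_ring_1) mpol mat"
  assumes A: "A \<in> carrier_mat (length s) (length t)"
    and deg: "\<And>i j. i < length s \<Longrightarrow> j < length t \<Longrightarrow> A $$ (i, j) \<in> shifted_comp w (s ! i) (t ! j)"
    and v: "v \<in> free_comp w t g"
  shows "A *\<^sub>v v \<in> free_comp w s g"
  unfolding free_comp_iff
proof (intro conjI allI impI)
  have v': "v \<in> carrier_vec (length t)" "\<And>j. j < length t \<Longrightarrow> v $ j \<in> shifted_comp w (t ! j) g"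
    using v by (auto simp: free_comp_iff)
  show "A *\<^sub>v v \<in> carrier_vec (length s)" by (rule mult_mat_vec_carrier[OF A v'(1)])
  fix i assume i: "i < length s"
  show "(A *\<^sub>v v) $ i \<in> shifted_comp w (s ! i) g"
    unfolding mult_mat_vec_nth[OF A v'(1) i]
    by (intro shifted_comp_sum shifted_comp_mult[OF deg v'(2)]) (use i in auto)
qed

text \<open>
  All degrees that occur are of the form \<open>p a + q d\<close>. Keeping the coordinates \<open>p\<close> and \<open>q\<close> explicit
  turns the comparison of degrees into numeral arithmetic.
\<close>

definition lattice_pt :: "nat \<times> nat \<Rightarrow> nat \<times> nat \<Rightarrow> nat \<Rightarrow> nat \<Rightarrow> nat \<times> nat" where
  "lattice_pt a d p q = nscale p a + nscale q d"

lemma lattice_pt_add: "lattice_pt a d p q + lattice_pt a d p' q' = lattice_pt a d (p + p') (q + q')"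
  by (simp add: lattice_pt_def nscale_add ac_simps)

lemma wt_eq_lattice_pt:
  "wt a d V1 = lattice_pt a d 1 0" "wt a d V2 = lattice_pt a d 1 1" "wt a d V3 = lattice_pt a d 1 2"
  "wt a d V4 = lattice_pt a d 1 3" "wt a d V5 = lattice_pt a d 1 4"
  by (simp_all add: lattice_pt_def)

text \<open>
  The degrees of the basis vectors. For \<open>i \<ge> 1\<close> the \<open>i\<close>-th free module lives in total degree \<open>i + 1\<close>, since the
  quadrics are followed by linear syzygies; the lists give the multiples of \<open>d\<close>.
\<close>

definition shifts1 :: "nat \<times> nat \<Rightarrow> nat \<times> nat \<Rightarrow> (nat \<times> nat) list" where
  "shifts1 a d = map (lattice_pt a d 2) [2, 3, 4, 4, 5, 6]"
definition shifts2 :: "nat \<times> nat \<Rightarrow> nat \<times> nat \<Rightarrow> (nat \<times> nat) list" where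
  "shifts2 a d = map (lattice_pt a d 3) [4, 5, 5, 6, 6, 7, 7, 8]"
definition shifts3 :: "nat \<times> nat \<Rightarrow> nat \<times> nat \<Rightarrow> (nat \<times> nat) list" where
  "shifts3 a d = map (lattice_pt a d 4) [7, 8, 9]"

lemma shifted_comp_quadric:
  fixes w :: "'v::finite \<Rightarrow> 'g::comm_monoid_add"
  shows "w i + w j + s = g \<Longrightarrow> (Var i * Var j :: ('v, 'k::comm_ring_1) mpol) \<in> shifted_comp w s g"
  by (rule shifted_comp_mult[of _ _ _ "w i + s"]) (auto intro!: shifted_comp_Var simp: ac_simps)

lemma delta1_degrees:
  assumes "i < 1" "j < 6"
  shows "(delta1 $$ (i, j) :: (var5, 'k::comm_ring_1) mpol) \<in> shifted_comp (wt a d) ([0] ! i) (shifts1 a d ! j)"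
proof -
  have "\<forall>j<6. (delta1 $$ (0, j) :: (var5, 'k) mpol) \<in> shifted_comp (wt a d) 0 (shifts1 a d ! j)"
    unfolding all_less_3_6_8
    by (simp add: delta1_def mat_of_rows_list_nth shifts1_def, simp only: power2_eq_square,
        intro conjI shifted_comp_diff shifted_comp_quadric)
       (simp_all del: wt.simps add: wt_eq_lattice_pt lattice_pt_add numeral_eq_Suc)
  then show ?thesis using assms by simp
qed

lemma delta2_degrees:
  assumes "i < 6" "j < 8"
  shows "(delta2 $$ (i, j) :: (var5, 'k::comm_ring_1) mpol) \<in> shifted_comp (wt a d) (shifts1 a d ! i) (shifts2 a d ! j)"
proof -
  have "\<forall>i<6. \<forall>j<8. (delta2 $$ (i, j) :: (var5, 'k) mpol) \<in> shifted_comp (wt a d) (shifts1 a d ! i) (shifts2 a d ! j)"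
    unfolding all_less_3_6_8
    by (simp add: delta2_def mat_of_rows_list_nth shifts1_def shifts2_def,
        intro conjI shifted_comp_0 shifted_comp_uminus shifted_comp_Var)
       (simp_all del: wt.simps add: wt_eq_lattice_pt lattice_pt_add numeral_eq_Suc)
  then show ?thesis using assms by simp
qed

lemma delta3_degrees:
  assumes "i < 8" "j < 3"
  shows "(delta3 $$ (i, j) :: (var5, 'k::comm_ring_1) mpol) \<in> shifted_comp (wt a d) (shifts2 a d ! i) (shifts3 a d ! j)"
proof -
  have "\<forall>i<8. \<forall>j<3. (delta3 $$ (i, j) :: (var5, 'k) mpol) \<in> shifted_comp (wt a d) (shifts2 a d ! i) (shifts3 a d ! j)"
    unfolding all_less_3_6_8
    by (simp add: delta3_def mat_of_rows_list_nth shifts2_def shifts3_def,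
        intro conjI shifted_comp_0 shifted_comp_uminus shifted_comp_Var)
       (simp_all del: wt.simps add: wt_eq_lattice_pt lattice_pt_add numeral_eq_Suc)
  then show ?thesis using assms by simp
qed

lemma irrelevant_ideal: "ideal irrelevant_ideal (class_ring :: ('v::finite, 'k::comm_ring_1) mpol ring)"
  unfolding irrelevant_ideal_def
  by (rule ring.genideal_ideal[OF cring.axioms(1)[OF cring_class_ring]]) simp

lemma irrelevant_ideal_Var: "Var i \<in> (irrelevant_ideal :: ('v::finite, 'k::comm_ring_1) mpol set)"
  using ring.genideal_self[OF cring.axioms(1)[OF cring_class_ring], of "range Var :: ('v, 'k) mpol set"]
  unfolding irrelevant_ideal_def by auto

lemma irrelevant_ideal_closed:
  fixes f g :: "('v::finite, 'k::comm_ring_1) mpol"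
  shows "0 \<in> (irrelevant_ideal :: ('v, 'k) mpol set)"
    and "f \<in> irrelevant_ideal \<Longrightarrow> g \<in> irrelevant_ideal \<Longrightarrow> f + g \<in> irrelevant_ideal"
    and "f \<in> irrelevant_ideal \<Longrightarrow> f * g \<in> irrelevant_ideal"
    and "f \<in> irrelevant_ideal \<Longrightarrow> - f \<in> irrelevant_ideal"
proof -
  note I = irrelevant_ideal[where 'v = 'v and 'k = 'k]
  note sub = ideal.axioms(1)[OF I]
  show "0 \<in> (irrelevant_ideal :: ('v, 'k) mpol set)"
    using additive_subgroup.zero_closed[OF sub] by simp
  show add: "f + g \<in> irrelevant_ideal" if "f \<in> irrelevant_ideal" "g \<in> irrelevant_ideal"
    using additive_subgroup.a_closed[OF sub that] by simp
  show mult: "f * g \<in> irrelevant_ideal" if "f \<in> irrelevant_ideal" for g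
    using ideal.I_r_closed[OF I that, of g] by simp
  show "- f \<in> irrelevant_ideal" if "f \<in> irrelevant_ideal"
    using mult[OF that, of "- 1"] by simp
qed

lemma irrelevant_ideal_diff:
  fixes f g :: "('v::finite, 'k::comm_ring_1) mpol"
  shows "f \<in> irrelevant_ideal \<Longrightarrow> g \<in> irrelevant_ideal \<Longrightarrow> f - g \<in> irrelevant_ideal"
  using irrelevant_ideal_closed(2)[of f "- g"] irrelevant_ideal_closed(4)[of g] by simp

lemma mat_image_in_irrelevant_ideal:
  fixes A :: "('v::finite, 'k::comm_ring_1) mpol mat"
  assumes A: "A \<in> carrier_mat n m"
    and entries: "\<And>i j. i < n \<Longrightarrow> j < m \<Longrightarrow> A $$ (i, j) \<in> irrelevant_ideal"
    and "y \<in> mat_image A" "i < n"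
  shows "y $ i \<in> irrelevant_ideal"
proof -
  obtain v where v: "v \<in> carrier_vec m" "y = A *\<^sub>v v"
    using assms(1,3) by (auto simp: mat_image_def)
  have sum_closed: "(\<Sum>j\<in>J. f j) \<in> irrelevant_ideal"
    if "\<And>j. j \<in> J \<Longrightarrow> f j \<in> irrelevant_ideal"
    for J :: "nat set" and f :: "nat \<Rightarrow> ('v, 'k) mpol"
    using that by (induction J rule: infinite_finite_induct) (auto intro: irrelevant_ideal_closed)
  show ?thesis
    unfolding v(2) mult_mat_vec_nth[OF A v(1) assms(4)]
    by (intro sum_closed irrelevant_ideal_closed(3) entries) (use assms(4) in auto)
qed

lemma delta1_entries_irrelevant:
  assumes "i < 1" "j < 6"
  shows "(delta1 $$ (i, j) :: (var5, 'k::comm_ring_1) mpol) \<in> irrelevant_ideal"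
proof -
  have "\<forall>j<6. (delta1 $$ (0, j) :: (var5, 'k) mpol) \<in> irrelevant_ideal"
    unfolding all_less_3_6_8
    by (simp add: delta1_def mat_of_rows_list_nth, simp only: power2_eq_square)
       (intro conjI irrelevant_ideal_diff irrelevant_ideal_closed(3) irrelevant_ideal_Var)
  then show ?thesis using assms by simp
qed

lemma delta2_entries_irrelevant:
  assumes "i < 6" "j < 8"
  shows "(delta2 $$ (i, j) :: (var5, 'k::comm_ring_1) mpol) \<in> irrelevant_ideal"
proof -
  have "\<forall>i<6. \<forall>j<8. (delta2 $$ (i, j) :: (var5, 'k) mpol) \<in> irrelevant_ideal"
    unfolding all_less_3_6_8
    by (simp add: delta2_def mat_of_rows_list_nth)
       (intro conjI irrelevant_ideal_closed(1,4) irrelevant_ideal_Var)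
  then show ?thesis using assms by simp
qed

lemma delta3_entries_irrelevant:
  assumes "i < 8" "j < 3"
  shows "(delta3 $$ (i, j) :: (var5, 'k::comm_ring_1) mpol) \<in> irrelevant_ideal"
proof -
  have "\<forall>i<8. \<forall>j<3. (delta3 $$ (i, j) :: (var5, 'k) mpol) \<in> irrelevant_ideal"
    unfolding all_less_3_6_8
    by (simp add: delta3_def mat_of_rows_list_nth)
       (intro conjI irrelevant_ideal_closed(1,4) irrelevant_ideal_Var)
  then show ?thesis using assms by simp
qed

section \<open>The semigroup ring\<close>

lemma affine_semigroup_range:
  fixes w :: "'v::finite \<Rightarrow> 'g::comm_monoid_add"
  assumes "inj w"
  shows "affine_semigroup (range w) = range (monom_deg w)"
proof
  show "affine_semigroup (range w) \<subseteq> range (monom_deg w)"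
  proof
    fix g assume "g \<in> affine_semigroup (range w)"
    then obtain l where l: "g = (\<Sum>v\<in>range w. nscale (l v) v)"
      by (auto simp: affine_semigroup_def)
    have "g = (\<Sum>i\<in>UNIV. nscale (l (w i)) (w i))"
      unfolding l by (subst sum.reindex[OF assms]) simp
    also have "\<dots> = monom_deg w (Abs_poly_mapping (\<lambda>i. l (w i)))"
      by (simp add: monom_deg_def)
    finally show "g \<in> range (monom_deg w)" by blast
  qed
  show "range (monom_deg w) \<subseteq> affine_semigroup (range w)"
  proof
    fix g assume "g \<in> range (monom_deg w)"
    then obtain m where m: "g = monom_deg w m" by blast
    have "g = (\<Sum>v\<in>range w. nscale (lookup m (inv_into UNIV w v)) v)"
      unfolding m monom_deg_def by (subst sum.reindex[OF assms]) (simp add: assms)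
    then show "g \<in> affine_semigroup (range w)"
      unfolding affine_semigroup_def
      by (intro CollectI exI[of _ "\<lambda>v. lookup m (inv_into UNIV w v)"]) simp
  qed
qed

lemma inj_wt:
  assumes "lin_indep_rat a d"
  shows "inj (wt a d)"
proof (rule injI)
  fix i j assume "wt a d i = wt a d j"
  then have "monom_deg (wt a d) (Poly_Mapping.single i 1) = monom_deg (wt a d) (Poly_Mapping.single j 1)"
    by (simp only: monom_deg_single)
  moreover have "monom_deg mid_wt (Poly_Mapping.single k 1) \<le> 1" for k
    unfolding monom_deg_single by (cases k) simp_all
  ultimately have "Poly_Mapping.single i (1::nat) = Poly_Mapping.single j 1"
    using inj_on_monom_deg_wt[OF assms] by (blast dest: inj_onD)
  then have "keys (Poly_Mapping.single i (1::nat)) = keys (Poly_Mapping.single j (1::nat))" by simp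
  then show "i = j" by simp
qed

lemma S_ad4_eq:
  assumes "lin_indep_rat a d"
  shows "S_ad4 a d = range (monom_deg (wt a d))"
proof -
  have "gens_ad4 a d = range (wt a d)" by (auto simp: gens_ad4_def UNIV_var5)
  then show ?thesis using affine_semigroup_range[OF inj_wt[OF assms]] by (simp add: S_ad4_def)
qed

lemma semigroup_ring_simps:
  "carrier (semigroup_ring S) = {f. keys f \<subseteq> S}" "mult (semigroup_ring S) = (*)"
  "one (semigroup_ring S) = 1" "zero (semigroup_ring S) = 0" "add (semigroup_ring S) = (+)"
  by (simp_all add: semigroup_ring_def)

lemma cring_semigroup_ring:
  fixes S :: "'g::comm_monoid_add set"
  assumes "0 \<in> S" "\<And>s t. s \<in> S \<Longrightarrow> t \<in> S \<Longrightarrow> s + t \<in> S"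
  shows "cring (semigroup_ring S :: ('g \<Rightarrow>\<^sub>0 'k::comm_ring_1) ring)"
proof (rule cringI)
  let ?R = "semigroup_ring S :: ('g \<Rightarrow>\<^sub>0 'k) ring"
  have mult: "keys (f * f') \<subseteq> S"
    if "keys f \<subseteq> S" "keys f' \<subseteq> S" for f f' :: "'g \<Rightarrow>\<^sub>0 'k"
    using that keys_mult[of f f'] assms(2) by blast
  have add: "keys (f + f') \<subseteq> S"
    if "keys f \<subseteq> S" "keys f' \<subseteq> S" for f f' :: "'g \<Rightarrow>\<^sub>0 'k"
    using that keys_add[of f f'] by blast
  show "abelian_group ?R"
  proof (rule abelian_groupI)
    fix x assume "x \<in> carrier ?R"
    then show "\<exists>y\<in>carrier ?R. y \<oplus>\<^bsub>?R\<^esub> x = \<zero>\<^bsub>?R\<^esub>"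
      by (intro bexI[of _ "- x"]) (auto simp: semigroup_ring_simps in_keys_iff subset_iff)
  qed (auto simp: semigroup_ring_simps ac_simps dest: add[THEN subsetD, rotated 2])
  show "comm_monoid ?R"
    by (rule comm_monoidI)
       (use mult assms(1) in \<open>auto simp: semigroup_ring_simps ac_simps\<close>)
qed (simp add: semigroup_ring_simps algebra_simps)

lemma cring_S_ad4:
  assumes "lin_indep_rat a d"
  shows "cring (semigroup_ring (S_ad4 a d) :: ((nat \<times> nat) \<Rightarrow>\<^sub>0 'k::comm_ring_1) ring)"
proof (rule cring_semigroup_ring)
  show "0 \<in> S_ad4 a d"
    unfolding S_ad4_eq[OF assms] by (rule image_eqI[of _ _ 0]) simp_all
  show "s + t \<in> S_ad4 a d" if "s \<in> S_ad4 a d" "t \<in> S_ad4 a d" for s t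
    using that unfolding S_ad4_eq[OF assms] by (auto simp flip: monom_deg_add)
qed

lemma phi_ring_hom:
  assumes "lin_indep_rat a d"
  shows "(phi a d :: (var5, 'k::comm_ring_1) mpol \<Rightarrow> _) \<in>
    Ring.ring_hom class_ring (semigroup_ring (S_ad4 a d))"
  using keys_monom_map
  by (intro ring_hom_memI)
     (simp_all add: phi_eq_monom_map semigroup_ring_simps S_ad4_eq[OF assms] monom_map_mult monom_map_add)

lemma range_phi:
  assumes "lin_indep_rat a d"
  shows "range (phi a d :: (var5, 'k::comm_ring_1) mpol \<Rightarrow> _) = carrier (semigroup_ring (S_ad4 a d))"
proof
  show "range (phi a d) \<subseteq> carrier (semigroup_ring (S_ad4 a d) :: (_ \<Rightarrow>\<^sub>0 'k) ring)"
    using ring_hom_closed[OF phi_ring_hom[OF assms]] by auto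
  show "carrier (semigroup_ring (S_ad4 a d)) \<subseteq> range (phi a d :: (var5, 'k) mpol \<Rightarrow> _)"
    unfolding semigroup_ring_simps S_ad4_eq[OF assms] phi_eq_monom_map
    by (blast elim: monom_map_surj)
qed

lemma phi_hcomp: "phi a d f = 0 \<Longrightarrow> phi a d (hcomp (wt a d) g f) = 0"
  by (simp add: phi_eq_monom_map monom_map_hcomp)

text \<open>
  If \<open>p\<close> is a multiple of \<open>t\<^sup>g\<close> and \<open>f\<close> is any preimage of it, then the component of \<open>f\<close> of degree
  \<open>g\<close> is a preimage as well.
\<close>

lemma phi_homog_comp:
  assumes "lin_indep_rat a d"
  shows "phi a d ` (homog_comp (wt a d) g :: (var5, 'k::comm_ring_1) mpol set) =
    semigroup_ring_comp (S_ad4 a d) g"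
proof
  show "phi a d ` (homog_comp (wt a d) g :: (var5, 'k) mpol set) \<subseteq> semigroup_ring_comp (S_ad4 a d) g"
  proof (rule image_subsetI)
    fix f :: "(var5, 'k) mpol" assume f: "f \<in> homog_comp (wt a d) g"
    have "phi a d f \<in> carrier (semigroup_ring (S_ad4 a d))" using range_phi[OF assms] by blast
    moreover have "keys (phi a d f) \<subseteq> {g}"
      unfolding phi_eq_monom_map by (subst monom_map_homog[OF f]) simp
    ultimately show "phi a d f \<in> semigroup_ring_comp (S_ad4 a d) g"
      by (simp add: semigroup_ring_comp_def)
  qed
  show "semigroup_ring_comp (S_ad4 a d) g \<subseteq> phi a d ` (homog_comp (wt a d) g :: (var5, 'k) mpol set)"
  proof
    fix p :: "(nat \<times> nat) \<Rightarrow>\<^sub>0 'k" assume p: "p \<in> semigroup_ring_comp (S_ad4 a d) g"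
    then have "p \<in> range (phi a d :: (var5, 'k) mpol \<Rightarrow> _)"
      unfolding range_phi[OF assms] by (simp add: semigroup_ring_comp_def)
    then obtain f :: "(var5, 'k) mpol" where f: "p = phi a d f" by blast
    have "p = Poly_Mapping.single g (lookup p g)"
      using p by (intro poly_mapping_eqI)
        (auto simp: semigroup_ring_comp_def lookup_single when_def in_keys_iff)
    then have "p = phi a d (hcomp (wt a d) g f)"
      by (simp add: f phi_eq_monom_map monom_map_hcomp)
    then show "p \<in> phi a d ` (homog_comp (wt a d) g :: (var5, 'k) mpol set)" by simp
  qed
qed

section \<open>The resolution\<close>

lemma all_less_length_3: "(\<forall>i<length [A, B, C]. P i) \<longleftrightarrow> P 0 \<and> P 1 \<and> P 2"
  using all_less_3_6_8(1)[of P] by (simp add: numeral_eq_Suc)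

text \<open>
  The module enters only through the kernel of \<open>\<psi>\<close>, so \<open>R/I\<close> and the semigroup ring are treated
  alike.
\<close>

lemma resolution_of_cyclic_module:
  fixes M :: "((var5, 'k::comm_ring_1) mpol, 'm) module"
  assumes li: "lin_indep_rat a d"
    and M: "Module.module class_ring M"
    and add: "\<And>f f'. \<psi> (f + f') = \<psi> f \<oplus>\<^bsub>M\<^esub> \<psi> f'"
    and mult: "\<And>r f. \<psi> (r * f) = r \<odot>\<^bsub>M\<^esub> \<psi> f"
    and surj: "range \<psi> = carrier M"
    and ker: "\<And>f. \<psi> f = \<zero>\<^bsub>M\<^esub> \<longleftrightarrow> phi a d f = 0"
  shows "minimal_graded_free_resolution (wt a d) [[0], shifts1 a d, shifts2 a d, shifts3 a d]
    [delta1, delta2, delta3] (\<lambda>v. \<psi> (v $ 0)) M (\<lambda>g. \<psi> ` homog_comp (wt a d) g)"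
proof -
  interpret graded_cyclic_module "wt a d" M \<psi>
    by (rule graded_cyclic_module.intro) (simp_all add: M add mult surj ker phi_hcomp)
  have lens: "length (shifts1 a d) = 6" "length (shifts2 a d) = 8" "length (shifts3 a d) = 3"
    by (simp_all add: shifts1_def shifts2_def shifts3_def)
  have image: "{v \<in> carrier_vec 1. \<psi> (v $ 0) = \<zero>\<^bsub>M\<^esub>} = mat_image (delta1 :: (var5, 'k) mpol mat)"
  proof (rule equalityI; rule subsetI)
    fix v :: "(var5, 'k) mpol vec" assume "v \<in> {v \<in> carrier_vec 1. \<psi> (v $ 0) = \<zero>\<^bsub>M\<^esub>}"
    then have v: "v \<in> carrier_vec 1" and "phi a d (v $ 0) = 0" by (simp_all add: ker)
    then obtain u where u: "u \<in> carrier_vec 6" "v $ 0 = (delta1 *\<^sub>v u) $ 0"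
      using phi_eq_0_iff[OF li] by blast
    have "v = delta1 *\<^sub>v u"
      using u(2)
        by (intro eq_vec_by_entries[OF v mult_mat_vec_carrier[OF delta_carrier(1) u(1)]]) simp
    with u(1) show "v \<in> mat_image delta1"
      by (simp add: mat_image_def carrier_matD[OF delta_carrier(1)])
  next
    fix v :: "(var5, 'k) mpol vec" assume "v \<in> mat_image delta1"
    then obtain u where u: "u \<in> carrier_vec 6" "v = delta1 *\<^sub>v u"
      by (auto simp: mat_image_def carrier_matD[OF delta_carrier(1)])
    then show "v \<in> {v \<in> carrier_vec 1. \<psi> (v $ 0) = \<zero>\<^bsub>M\<^esub>}"
      by (simp add: ker phi_delta1 mult_mat_vec_carrier[OF delta_carrier(1)] del: One_nat_def)
  qed
  have deg: "delta1 *\<^sub>v v \<in> free_comp (wt a d) [0] g"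
    if "v \<in> free_comp (wt a d) (shifts1 a d) g"
    for v :: "(var5, 'k) mpol vec" and g
    by (rule mult_mat_vec_in_free_comp[OF _ _ that])
       (use delta_carrier(1) delta1_degrees in \<open>simp_all add: lens\<close>)
  have deg2: "delta2 *\<^sub>v v \<in> free_comp (wt a d) (shifts1 a d) g"
    if "v \<in> free_comp (wt a d) (shifts2 a d) g"
    for v :: "(var5, 'k) mpol vec" and g
    by (rule mult_mat_vec_in_free_comp[OF _ _ that]) (simp_all add: lens delta2_degrees)
  have deg3: "delta3 *\<^sub>v v \<in> free_comp (wt a d) (shifts2 a d) g"
    if "v \<in> free_comp (wt a d) (shifts3 a d) g"
    for v :: "(var5, 'k) mpol vec" and g
    by (rule mult_mat_vec_in_free_comp[OF _ _ that]) (simp_all add: lens delta3_degrees)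
  show ?thesis
    unfolding minimal_graded_free_resolution_def all_less_length_3
  proof (intro conjI)
    show "graded_module (wt a d) M (\<lambda>g. \<psi> ` homog_comp (wt a d) g)"
      by (fact graded_module)
    show "mod_hom class_ring (module_vec TYPE((var5, 'k) mpol) (length ([[0], shifts1 a d, shifts2 a d, shifts3 a d] ! 0)))
        M (\<lambda>v. \<psi> (v $ 0))"
      using mod_hom_first_entry by simp
    show "(\<lambda>v. \<psi> (v $ 0)) ` carrier_vec (length ([[0], shifts1 a d, shifts2 a d, shifts3 a d] ! 0)) = carrier M"
      using image_first_entry by simp
    show "{v \<in> carrier_vec (length ([[0], shifts1 a d, shifts2 a d, shifts3 a d] ! 0)). \<psi> (v $ 0) = \<zero>\<^bsub>M\<^esub>} =
        incoming_image [delta1, delta2, delta3] (length ([[0], shifts1 a d, shifts2 a d, shifts3 a d] ! 0)) 0"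
      using image by (simp add: incoming_image_def)
    show "\<forall>g. \<forall>v\<in>free_comp (wt a d) ([[0], shifts1 a d, shifts2 a d, shifts3 a d] ! 0) g.
        \<psi> (v $ 0) \<in> \<psi> ` homog_comp (wt a d) g"
      by (auto simp: free_comp_def homog_comp_def)
  qed (use deg deg2 deg3 delta_carrier in \<open>auto simp: lens incoming_image_def
      mat_kernel_delta1 mat_kernel_delta2 mat_kernel_delta3 numeral_2_eq_2
      intro: mat_image_in_irrelevant_ideal[OF delta_carrier(1) delta1_entries_irrelevant]
        mat_image_in_irrelevant_ideal[OF delta_carrier(2) delta2_entries_irrelevant]
        mat_image_in_irrelevant_ideal[OF delta_carrier(3) delta3_entries_irrelevant]\<close>)
qed

theorem proposition5p4:
  fixes a d :: "nat \<times> nat"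
  assumes "lin_indep_rat a d"
    and "minimal_generating_set
           {a, a + d, a + nscale 2 d, a + nscale 3 d, a + nscale 4 d} (S_ad4 a d)"
  shows "\<exists>s1 s2 s3 :: (nat \<times> nat) list.
    length s1 = 6 \<and> length s2 = 8 \<and> length s3 = 3 \<and>
    minimal_graded_free_resolution (wt a d) [[0], s1, s2, s3]
      [\<delta>\<^sub>1, \<delta>\<^sub>2, \<delta>\<^sub>3 :: (var5, 'k::field) mpol mat]
      (\<lambda>v. quot_map a d (v $ 0))
      (restrict_scalars (quot_map a d) (class_ring Quot I_ad4 a d))
      (\<lambda>g. quot_map a d ` homog_comp (wt a d) g) \<and>
    minimal_graded_free_resolution (wt a d) [[0], s1, s2, s3]
      [\<delta>\<^sub>1, \<delta>\<^sub>2, \<delta>\<^sub>3 :: (var5, 'k) mpol mat]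
      (\<lambda>v. phi a d (v $ 0))
      (restrict_scalars (phi a d) (semigroup_ring (S_ad4 a d)))
      (semigroup_ring_comp (S_ad4 a d))"
proof (intro exI conjI)
  let ?phi = "phi a d :: (var5, 'k) mpol \<Rightarrow> _" and ?q = "quot_map a d :: (var5, 'k) mpol \<Rightarrow> _"
    and ?I = "I_ad4 a d :: (var5, 'k) mpol set"
  let ?Q = "class_ring Quot ?I"
  note li = assms(1)
  note R = cring_class_ring[where 'a = "(var5, 'k) mpol"]
  have I: "ideal ?I class_ring"
    unfolding I_ad4_def
    by (intro ring_hom_ring.kernel_is_ideal ring_hom_ringI2[OF cring.axioms(1)[OF R] cring.axioms(1)[OF cring_S_ad4[OF li]]]
        phi_ring_hom[OF li])
  have mem_I: "f \<in> ?I \<longleftrightarrow> phi a d f = 0" for f :: "(var5, 'k) mpol"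
    by (simp add: I_ad4_def a_kernel_def' semigroup_ring_simps)
  have q_hom: "?q \<in> Ring.ring_hom class_ring ?Q"
    using ideal.rcos_ring_hom[OF I] by (simp add: quot_map_def[abs_def])
  have q_0: "?q f = \<zero>\<^bsub>?Q\<^esub> \<longleftrightarrow> f \<in> ?I" for f
    using ring.a_rcos_zero[OF cring.axioms(1)[OF R] I, of f] ideal.rcos_const_imp_mem[OF I, of f]
    by (auto simp: quot_map_def FactRing_def)
  show "minimal_graded_free_resolution (wt a d) [[0], shifts1 a d, shifts2 a d, shifts3 a d]
      [\<delta>\<^sub>1, \<delta>\<^sub>2, \<delta>\<^sub>3 :: (var5, 'k::field) mpol mat] (\<lambda>v. quot_map a d (v $ 0))
      (restrict_scalars (quot_map a d) (class_ring Quot I_ad4 a d))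
      (\<lambda>g. quot_map a d ` homog_comp (wt a d) g)"
  proof (rule resolution_of_cyclic_module[OF li])
    show "Module.module class_ring (restrict_scalars ?q ?Q)"
      by (rule module_restrict_scalars[OF ideal.quotient_is_cring[OF I R] q_hom])
    show "range ?q = carrier (restrict_scalars ?q ?Q)"
      by (auto simp: restrict_scalars_simps quot_map_def FactRing_def A_RCOSETS_def')
  qed (use ring_hom_add[OF q_hom] ring_hom_mult[OF q_hom] in
      \<open>simp_all add: restrict_scalars_simps q_0 mem_I\<close>)
  have "minimal_graded_free_resolution (wt a d) [[0], shifts1 a d, shifts2 a d, shifts3 a d]
      [\<delta>\<^sub>1, \<delta>\<^sub>2, \<delta>\<^sub>3 :: (var5, 'k) mpol mat] (\<lambda>v. phi a d (v $ 0))
      (restrict_scalars (phi a d) (semigroup_ring (S_ad4 a d))) (\<lambda>g. ?phi ` homog_comp (wt a d) g)"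
  proof (rule resolution_of_cyclic_module[OF li])
    show "Module.module class_ring (restrict_scalars ?phi (semigroup_ring (S_ad4 a d)))"
      by (rule module_restrict_scalars[OF cring_S_ad4[OF li] phi_ring_hom[OF li]])
  qed (use range_phi[OF li] in
      \<open>simp_all add: restrict_scalars_simps semigroup_ring_simps phi_eq_monom_map monom_map_add monom_map_mult\<close>)
  then show "minimal_graded_free_resolution (wt a d) [[0], shifts1 a d, shifts2 a d, shifts3 a d]
      [\<delta>\<^sub>1, \<delta>\<^sub>2, \<delta>\<^sub>3 :: (var5, 'k) mpol mat] (\<lambda>v. phi a d (v $ 0))
      (restrict_scalars (phi a d) (semigroup_ring (S_ad4 a d))) (semigroup_ring_comp (S_ad4 a d))"
    unfolding phi_homog_comp[OF li] .
qed (simp_all add: shifts1_def shifts2_def shifts3_def)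

end
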